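(* Let $\rho$ be a fixed state on $\mathcal H_L$ and let $\mathcal N,\mathcal N':\mathsf L(\mathcal H_C)\to\mathsf L(\mathcal H_C)$ be completely positive trace-non-increasing (CPTNI) maps. Then $$|\Delta^{\mathrm{opt}}(\rho,\mathcal N)-\Delta^{\mathrm{opt}}(\rho,\mathcal N')|\le2\,\|\mathcal N-\mathcal N'\|_\diamond .$$ If moreover $\mathcal N$ and $\mathcal N'$ are completely positive and trace preserving, then $$|\Delta^{\mathrm{opt}}(\rho,\mathcal N)-\Delta^{\mathrm{opt}}(\rho,\mathcal N')|\le\|\mathcal N-\mathcal N'\|_\diamond .$$
   Context: $\mathcal H_L=\mathbb C^{d_L}$ and $\mathcal H_C=\mathbb C^{d_C}$ with $1<d_L\le d_C<\infty$; $\mathsf L(\mathcal H)$ is the space of linear operators on $\mathcal H$. A CPTNI map is a completely positive map with $\sum_jL_j^\dagger L_j\preceq I$ for its Kraus operators $L_j$. $\|\cdot\|_\diamond$ is the diamond norm, $\|\Lambda\|_\diamond=\sup_{n}\sup_{\|X\|_1\le1}\|(\mathrm{id}_n\otimes\Lambda)(X)\|_1$, with $\|\cdot\|_1$ the trace norm. For a completely positive map $\Phi$ on $\mathsf L(\mathcal H_L)$ with Kraus operators $F_j$, the entanglement fidelity is $F_{\mathrm e}(\rho,\Phi):=\sum_j|\operatorname{tr}(\rho F_j)|^2$. For an encoder $\mathcal C:\mathsf L(\mathcal H_L)\to\mathsf L(\mathcal H_C)$, $r_{\mathcal C}$ denotes its Choi rank (the minimum number of Kraus operators). Define $$F^{\mathrm{opt}}(\rho,\mathcal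 N):=\max_{\mathcal C,\mathcal D}F_{\mathrm e}(\rho,\mathcal D\circ\mathcal N\circ\mathcal C),\qquad F^{\mathrm{opt}}_1(\rho,\mathcal N):=\max_{\mathcal C,\mathcal D:\ r_{\mathcal C}\le1}F_{\mathrm e}(\rho,\mathcal D\circ\mathcal N\circ\mathcal C),$$ where $\mathcal C:\mathsf L(\mathcal H_L)\to\mathsf L(\mathcal H_C)$ and $\mathcal D:\mathsf L(\mathcal H_C)\to\mathsf L(\mathcal H_L)$ range over CPTNI maps (with the additional constraint $r_{\mathcal C}\le1$ in the second), and $\Delta^{\mathrm{opt}}(\rho,\mathcal N):=F^{\mathrm{opt}}(\rho,\mathcal N)-F^{\mathrm{opt}}_1(\rho,\mathcal N)$. *)

theory Defs
  imports
    "Jordan_Normal_Form.Schur_Decomposition"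
    "Jordan_Normal_Form.Char_Poly"
    "HOL-Computational_Algebra.Fundamental_Theorem_Algebra"
    "HOL-Library.Extended_Real"
begin

text \<open>
  Operators on the Hilbert space of dimension \<open>d\<close> are elements of \<open>carrier_mat d d\<close>. Linear
  maps between operator spaces are functions of type \<open>complex mat \<Rightarrow> complex mat\<close>; only their
  values on the relevant carrier matter, and every notion below depends on those values alone.
\<close>

definition mat_trace :: "complex mat \<Rightarrow> complex" where
  "mat_trace A = (\<Sum>i<dim_row A. A $$ (i, i))"

text \<open>The order on \<open>complex\<close> is the one of \<open>Complex_Order\<close>: \<open>0 \<le> z\<close> says that \<open>z\<close> is real and
  nonnegative.\<close>

definition psd :: "nat \<Rightarrow> complex mat \<Rightarrow> bool" where
  "psd d A \<longleftrightarrow> A \<in> carrier_mat d d \<and> (\<forall>v\<in>carrier_vec d. 0 \<le> (A *\<^sub>v v) \<bullet>c v)"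

definition density_operator :: "nat \<Rightarrow> complex mat \<Rightarrow> bool" where
  "density_operator d \<rho> \<longleftrightarrow> psd d \<rho> \<and> mat_trace \<rho> = 1"

text \<open>The sum of the singular values, that is, of the square roots of the eigenvalues of
  \<open>X\<^sup>\<dagger> X\<close>, counted with algebraic multiplicity.\<close>

definition trace_norm :: "complex mat \<Rightarrow> real" where
  "trace_norm X = (\<Sum>s\<in>#proots (char_poly (mat_adjoint X * X)). sqrt (Re s))"

definition mat_sum :: "nat \<Rightarrow> nat \<Rightarrow> complex mat list \<Rightarrow> complex mat" where
  "mat_sum nr nc As = foldr (+) As (0\<^sub>m nr nc)"

definition linear_mat_map :: "nat \<Rightarrow> nat \<Rightarrow> (complex mat \<Rightarrow> complex mat) \<Rightarrow> bool" where
  "linear_mat_map m n \<Phi> \<longleftrightarrow>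
     (\<forall>X\<in>carrier_mat m m. \<Phi> X \<in> carrier_mat n n) \<and>
     (\<forall>X\<in>carrier_mat m m. \<forall>Y\<in>carrier_mat m m. \<Phi> (X + Y) = \<Phi> X + \<Phi> Y) \<and>
     (\<forall>X\<in>carrier_mat m m. \<forall>c. \<Phi> (c \<cdot>\<^sub>m X) = c \<cdot>\<^sub>m \<Phi> X)"

text \<open>\<open>mat_block d X a b\<close> is the \<open>(a, b)\<close> block of size \<open>d \<times> d\<close> of \<open>X\<close>. On the tensor product of
  spaces of dimensions \<open>k\<close> and \<open>d\<close> the basis vector with indices \<open>a < k\<close> and \<open>i < d\<close> is numbered
  \<open>a * d + i\<close>, so that \<open>id\<^sub>k \<otimes> \<Phi>\<close> applies \<open>\<Phi>\<close> to each block.\<close>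

definition mat_block :: "nat \<Rightarrow> complex mat \<Rightarrow> nat \<Rightarrow> nat \<Rightarrow> complex mat" where
  "mat_block d X a b = mat d d (\<lambda>(i, j). X $$ (a * d + i, b * d + j))"

definition id_tensor ::
  "nat \<Rightarrow> nat \<Rightarrow> nat \<Rightarrow> (complex mat \<Rightarrow> complex mat) \<Rightarrow> complex mat \<Rightarrow> complex mat" where
  "id_tensor k m n \<Phi> X =
     mat (k * n) (k * n) (\<lambda>(i, j). \<Phi> (mat_block m X (i div n) (j div n)) $$ (i mod n, j mod n))"

definition completely_positive :: "nat \<Rightarrow> nat \<Rightarrow> (complex mat \<Rightarrow> complex mat) \<Rightarrow> bool" where
  "completely_positive m n \<Phi> \<longleftrightarrow>
     linear_mat_map m n \<Phi> \<and>
     (\<forall>k\<ge>1. \<forall>X. psd (k * m) X \<longrightarrow> psd (k * n) (id_tensor k m n \<Phi> X))"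

definition kraus_operators ::
  "nat \<Rightarrow> nat \<Rightarrow> complex mat list \<Rightarrow> (complex mat \<Rightarrow> complex mat) \<Rightarrow> bool" where
  "kraus_operators m n Ks \<Phi> \<longleftrightarrow>
     set Ks \<subseteq> carrier_mat n m \<and>
     (\<forall>X\<in>carrier_mat m m. \<Phi> X = mat_sum n n (map (\<lambda>K. K * X * mat_adjoint K) Ks))"

definition cptni :: "nat \<Rightarrow> nat \<Rightarrow> (complex mat \<Rightarrow> complex mat) \<Rightarrow> bool" where
  "cptni m n \<Phi> \<longleftrightarrow>
     completely_positive m n \<Phi> \<and>
     (\<exists>Ls. kraus_operators m n Ls \<Phi> \<and>
           psd m (1\<^sub>m m - mat_sum m m (map (\<lambda>L. mat_adjoint L * L) Ls)))"

definition cptp :: "nat \<Rightarrow> nat \<Rightarrow> (complex mat \<Rightarrow> complex mat) \<Rightarrow> bool" where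
  "cptp m n \<Phi> \<longleftrightarrow>
     completely_positive m n \<Phi> \<and> (\<forall>X\<in>carrier_mat m m. mat_trace (\<Phi> X) = mat_trace X)"

text \<open>The zero map has the empty list of Kraus operators and Choi rank \<open>0\<close>.\<close>

definition choi_rank :: "nat \<Rightarrow> nat \<Rightarrow> (complex mat \<Rightarrow> complex mat) \<Rightarrow> nat" where
  "choi_rank m n \<Phi> = (LEAST r. \<exists>Ks. kraus_operators m n Ks \<Phi> \<and> length Ks = r)"

text \<open>The value is an extended real, so that the supremum is meaningful without a boundedness
  argument.\<close>

definition diamond_norm :: "nat \<Rightarrow> nat \<Rightarrow> (complex mat \<Rightarrow> complex mat) \<Rightarrow> ereal" where
  "diamond_norm m n \<Lambda> =
     (SUP k\<in>{1..}. SUP X\<in>{X \<in> carrier_mat (k * m) (k * m). trace_norm X \<le> 1}.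
        ereal (trace_norm (id_tensor k m n \<Lambda> X)))"

definition kraus_fidelity :: "complex mat \<Rightarrow> complex mat list \<Rightarrow> real" where
  "kraus_fidelity \<rho> Fs = (\<Sum>F\<leftarrow>Fs. (cmod (mat_trace (\<rho> * F)))\<^sup>2)"

text \<open>The choice of Kraus operators is immaterial, see \<open>entanglement_fidelity_eq\<close> below.\<close>

definition entanglement_fidelity ::
  "nat \<Rightarrow> complex mat \<Rightarrow> (complex mat \<Rightarrow> complex mat) \<Rightarrow> real" where
  "entanglement_fidelity d \<rho> \<Phi> = kraus_fidelity \<rho> (SOME Fs. kraus_operators d d Fs \<Phi>)"

text \<open>The optimisations run over sets of fidelities that are nonempty (take zero maps) and bounded
  by \<open>1\<close>; by compactness the suprema are attained, so they are the maxima over encoders \<open>C\<close> and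
  decoders \<open>D\<close>.\<close>

definition F_opt :: "nat \<Rightarrow> nat \<Rightarrow> complex mat \<Rightarrow> (complex mat \<Rightarrow> complex mat) \<Rightarrow> real" where
  "F_opt dL dC \<rho> N =
     Sup {entanglement_fidelity dL \<rho> (D \<circ> N \<circ> C) | C D. cptni dL dC C \<and> cptni dC dL D}"

definition F_opt1 :: "nat \<Rightarrow> nat \<Rightarrow> complex mat \<Rightarrow> (complex mat \<Rightarrow> complex mat) \<Rightarrow> real" where
  "F_opt1 dL dC \<rho> N =
     Sup {entanglement_fidelity dL \<rho> (D \<circ> N \<circ> C) | C D.
            cptni dL dC C \<and> cptni dC dL D \<and> choi_rank dL dC C \<le> 1}"

definition Delta_opt :: "nat \<Rightarrow> nat \<Rightarrow> complex mat \<Rightarrow> (complex mat \<Rightarrow> complex mat) \<Rightarrow> real" where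
  "Delta_opt dL dC \<rho> N = F_opt dL dC \<rho> N - F_opt1 dL dC \<rho> N"

lemma mat_sum_carrier:
  "set As \<subseteq> carrier_mat nr nc \<Longrightarrow> mat_sum nr nc As \<in> carrier_mat nr nc"
  unfolding mat_sum_def by (induction As) auto

lemma mat_sum_index:
  assumes "set As \<subseteq> carrier_mat nr nc" "i < nr" "j < nc"
  shows "mat_sum nr nc As $$ (i, j) = (\<Sum>A\<leftarrow>As. A $$ (i, j))"
  using assms(1)
proof (induction As)
  case Nil
  then show ?case using assms(2,3) by (simp add: mat_sum_def)
next
  case (Cons A As)
  have "mat_sum nr nc As \<in> carrier_mat nr nc"
    using Cons.prems by (intro mat_sum_carrier) auto
  moreover have "mat_sum nr nc (A # As) = A + mat_sum nr nc As"
    by (simp add: mat_sum_def)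
  ultimately show ?case using Cons assms(2,3) by auto
qed

lemma mat_adjoint_dim [simp]:
  "dim_row (mat_adjoint A) = dim_col A" "dim_col (mat_adjoint A) = dim_row A"
  by (auto simp: mat_adjoint_def)

lemma mat_adjoint_index:
  "i < dim_col A \<Longrightarrow> j < dim_row A \<Longrightarrow> mat_adjoint A $$ (i, j) = cnj (A $$ (j, i))"
  by (simp add: mat_adjoint_def mat_of_rows_def)

text \<open>With \<open>E\<close> the matrix unit at position \<open>(a, c)\<close>, the map with Kraus operator \<open>K\<close> sends \<open>E\<close> to
  a matrix with entry \<open>K\<^sub>b\<^sub>a cnj K\<^sub>d\<^sub>c\<close> at \<open>(b, d)\<close>.\<close>

lemma kraus_term_unit:
  assumes "K \<in> carrier_mat n m" "a < m" "c < m" "b < n" "d < n"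
  shows "(K * mat m m (\<lambda>p. if p = (a, c) then 1 else 0) * mat_adjoint K) $$ (b, d)
         = K $$ (b, a) * cnj (K $$ (d, c))"
proof -
  let ?E = "mat m m (\<lambda>p. if p = (a, c) then 1 else (0::complex))"
  have KE: "(K * ?E) $$ (b, j) = (if j = c then K $$ (b, a) else 0)" if "j < m" for j
  proof -
    have "(K * ?E) $$ (b, j) = (\<Sum>i = 0..<m. K $$ (b, i) * (if i = a \<and> j = c then 1 else 0))"
      using assms that by (simp add: scalar_prod_def)
    also have "\<dots> = (\<Sum>i = 0..<m. if i = a then (if j = c then K $$ (b, a) else 0) else 0)"
      by (intro sum.cong) auto
    finally show ?thesis using assms by simp
  qed
  have "(K * ?E * mat_adjoint K) $$ (b, d)
        = (\<Sum>j = 0..<m. (K * ?E) $$ (b, j) * mat_adjoint K $$ (j, d))"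
    using assms by (simp add: scalar_prod_def)
  also have "\<dots> = (\<Sum>j = 0..<m. if j = c then K $$ (b, a) * cnj (K $$ (d, c)) else 0)"
  proof (intro sum.cong refl)
    fix j assume "j \<in> {0..<m}"
    then have "j < m" by simp
    moreover from this have "mat_adjoint K $$ (j, d) = cnj (K $$ (d, j))"
      using assms by (intro mat_adjoint_index) auto
    ultimately show "(K * ?E) $$ (b, j) * mat_adjoint K $$ (j, d)
        = (if j = c then K $$ (b, a) * cnj (K $$ (d, c)) else 0)"
      unfolding KE [OF \<open>j < m\<close>] by simp
  qed
  finally show ?thesis using assms by simp
qed

lemma kraus_fidelity_alt:
  assumes "\<rho> \<in> carrier_mat d d" "kraus_operators d d Fs \<Phi>"
  shows "of_real (kraus_fidelity \<rho> Fs) =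
    (\<Sum>a<d. \<Sum>b<d. \<Sum>a'<d. \<Sum>b'<d. \<rho> $$ (a, b) * cnj (\<rho> $$ (a', b')) *
       \<Phi> (mat d d (\<lambda>p. if p = (a, a') then 1 else 0)) $$ (b, b'))"
proof -
  let ?c = "\<lambda>a b a' b'. \<rho> $$ (a, b) * cnj (\<rho> $$ (a', b'))"
  have FC: "set Fs \<subseteq> carrier_mat d d"
    using assms(2) by (simp add: kraus_operators_def)
  then have expand: "of_real (kraus_fidelity \<rho> Fs) =
    (\<Sum>a<d. \<Sum>b<d. \<Sum>a'<d. \<Sum>b'<d. ?c a b a' b' *
       (\<Sum>F\<leftarrow>Fs. F $$ (b, a) * cnj (F $$ (b', a'))))"
  proof (induction Fs)
    case Nil
    then show ?case by (simp add: kraus_fidelity_def)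
  next
    case (Cons F Fs)
    have tr: "mat_trace (\<rho> * F) = (\<Sum>a<d. \<Sum>b<d. \<rho> $$ (a, b) * F $$ (b, a))"
      using assms(1) Cons.prems
      by (auto simp: mat_trace_def scalar_prod_def atLeast0LessThan intro!: sum.cong)
    let ?t = "mat_trace (\<rho> * F)"
    have tr': "cnj ?t = (\<Sum>a'<d. \<Sum>b'<d. cnj (\<rho> $$ (a', b')) * cnj (F $$ (b', a')))"
      unfolding tr by (simp only: cnj_sum complex_cnj_mult)
    have "of_real ((cmod ?t)\<^sup>2) = ?t * cnj ?t"
      by (rule complex_norm_square)
    also have "\<dots> = (\<Sum>a<d. \<Sum>b<d. \<rho> $$ (a, b) * F $$ (b, a) * cnj ?t)"
      by (subst (1) tr) (simp only: sum_distrib_right)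
    also have "\<dots> = (\<Sum>a<d. \<Sum>b<d. \<Sum>a'<d. \<Sum>b'<d. ?c a b a' b' *
        (F $$ (b, a) * cnj (F $$ (b', a'))))"
      unfolding tr' by (simp only: sum_distrib_left mult_ac)
    finally have "of_real (kraus_fidelity \<rho> (F # Fs)) =
        (\<Sum>a<d. \<Sum>b<d. \<Sum>a'<d. \<Sum>b'<d. ?c a b a' b' * (F $$ (b, a) * cnj (F $$ (b', a')))) +
        (\<Sum>a<d. \<Sum>b<d. \<Sum>a'<d. \<Sum>b'<d. ?c a b a' b' *
          (\<Sum>F\<leftarrow>Fs. F $$ (b, a) * cnj (F $$ (b', a'))))"
      using Cons.IH Cons.prems by (simp add: kraus_fidelity_def)
    then show ?case
      by (simp only: sum.distrib distrib_left list.map sum_list.Cons)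
  qed
  have "\<Phi> (mat d d (\<lambda>p. if p = (a, a') then 1 else 0)) $$ (b, b') =
      (\<Sum>F\<leftarrow>Fs. F $$ (b, a) * cnj (F $$ (b', a')))"
    if "a < d" "b < d" "a' < d" "b' < d" for a b a' b'
  proof -
    let ?E = "mat d d (\<lambda>p. if p = (a, a') then 1 else (0::complex))"
    let ?Xs = "map (\<lambda>K. K * ?E * mat_adjoint K) Fs"
    have "?E \<in> carrier_mat d d" by simp
    then have "\<Phi> ?E = mat_sum d d ?Xs"
      using assms(2) unfolding kraus_operators_def by blast
    moreover have Xs: "set ?Xs \<subseteq> carrier_mat d d"
    proof
      fix X assume "X \<in> set ?Xs"
      then obtain K where K: "K \<in> carrier_mat d d" and X: "X = K * ?E * mat_adjoint K"
        using FC by auto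
      have "mat_adjoint K \<in> carrier_mat d d"
        using K by (intro carrier_matI) auto
      then show "X \<in> carrier_mat d d"
        unfolding X using K by (intro mult_carrier_mat [of _ d d]) auto
    qed
    ultimately have "\<Phi> ?E $$ (b, b') = (\<Sum>X\<leftarrow>?Xs. X $$ (b, b'))"
      by (simp only: mat_sum_index [OF Xs that(2,4)])
    also have "\<dots> = (\<Sum>K\<leftarrow>Fs. (K * ?E * mat_adjoint K) $$ (b, b'))"
      by (simp only: map_map comp_def)
    also have "\<dots> = (\<Sum>F\<leftarrow>Fs. F $$ (b, a) * cnj (F $$ (b', a')))"
    proof (rule arg_cong [where f = sum_list], rule map_cong [OF refl])
      fix K assume "K \<in> set Fs"
      then have "K \<in> carrier_mat d d" using FC by blast
      then show "(K * ?E * mat_adjoint K) $$ (b, b') = K $$ (b, a) * cnj (K $$ (b', a'))"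
        by (rule kraus_term_unit [OF _ that(1,3,2,4)])
    qed
    finally show ?thesis .
  qed
  then show ?thesis
    unfolding expand by (intro sum.cong refl) simp
qed

lemma entanglement_fidelity_eq:
  assumes "\<rho> \<in> carrier_mat d d" "kraus_operators d d Fs \<Phi>"
  shows "entanglement_fidelity d \<rho> \<Phi> = kraus_fidelity \<rho> Fs"
proof -
  have "kraus_operators d d (SOME Fs. kraus_operators d d Fs \<Phi>) \<Phi>"
    using assms(2) by (rule someI)
  then have "complex_of_real (entanglement_fidelity d \<rho> \<Phi>) = complex_of_real (kraus_fidelity \<rho> Fs)"
    unfolding entanglement_fidelity_def kraus_fidelity_alt [OF assms]
    by (rule kraus_fidelity_alt [OF assms(1)])
  then show ?thesis by simp
qed

end

(* Write rho = A A^dag with tr(A^dag A) = 1, so that psi = vec A purifies rho. With e_k = vec(D_k^dag A)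
   and omega = (id (x) C)(psi psi^dag) the fidelity of D o N o C is sum_k <e_k| (id (x) N)(omega) |e_k>.
   Here omega is positive with trace at most 1, and Cauchy-Schwarz shows sum_k |<e_k|v>|^2 <= |v|^2.
   Diagonalising the Hermitian operator Y = (id (x) (N - N'))(omega) with eigenvalues mu_l, the
   difference of the two fidelities is q = sum_l mu_l t_l with 0 <= t_l <= 1. So
   |q| <= |Y|_1 <= |N - N'|_diamond, and also |2 q - tr Y| <= |Y|_1, which gains a factor 2 when
   tr Y = 0, as is the case for trace-preserving maps. Both optimal fidelities are suprema of
   fidelities over the same index set for N and N', so each contributes this bound once. *)
theory Submission
  imports Defs "HOL-Analysis.L2_Norm"
begin

section \<open>Unitary diagonalisation of Hermitian matrices\<close>

text \<open>The trace norm is defined through the roots of a characteristic polynomial, so a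
  spectral theorem with unitary eigenbasis and real eigenvalues comes first; it links the trace norm
  to quadratic forms for the two kinds of operators that occur, positive ones and the Hermitian
  difference \<open>Y\<close>, and it also provides the factor A of \<rho>. Positive operators are
  kept in the factored form sum_g g g^dag (\<open>gram\<close>). A map with Kraus operators K,
  tensored with the identity, replaces each vec B by the vectors vec (K B), so fidelities, traces
  and the input of the diamond norm are all read off from lists of vectors. The vectors e_k come
  from cyclicity of the trace: tr(A A^dag D N C) is the inner product of vec(D^dag A) with vec(N C
  A). The factor 2 for trace-preserving maps comes from centring: subtracting tr Y turns the weights
  t_l in [0, 1] of 2 q into 2 t_l - 1 in [-1, 1], which are still bounded by 1 in modulus. The
  diamond norm is probed only at the ancilla dimension \<open>d\<close> of \<rho> and at the input
  \<open>\<omega>\<close>, which gives the lower bound on the norm that both estimates use.\<close>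

lemma mult_mat_index:
  fixes A B :: "complex mat"
  assumes "A \<in> carrier_mat n m" "B \<in> carrier_mat m k" "i < n" "j < k"
  shows "(A * B) $$ (i, j) = (\<Sum>l<m. A $$ (i, l) * B $$ (l, j))"
  using assms by (simp add: scalar_prod_def atLeast0LessThan)

lemma mat_adjoint_carrier [simp]: "A \<in> carrier_mat n m \<Longrightarrow> mat_adjoint A \<in> carrier_mat m n"
  by (intro carrier_matI) auto

lemma mat_adjoint_adjoint [simp]: "mat_adjoint (mat_adjoint A) = (A :: complex mat)"
  by (intro eq_matI) (auto simp: mat_adjoint_index)

lemma mat_adjoint_mult:
  fixes A B :: "complex mat"
  assumes "A \<in> carrier_mat n m" "B \<in> carrier_mat m k"
  shows "mat_adjoint (A * B) = mat_adjoint B * mat_adjoint A"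
proof (rule eq_matI)
  fix i j assume "i < dim_row (mat_adjoint B * mat_adjoint A)" "j < dim_col (mat_adjoint B * mat_adjoint A)"
  then have ij: "i < k" "j < n" using assms by auto
  then have "mat_adjoint (A * B) $$ (i, j) = cnj (\<Sum>l<m. A $$ (j, l) * B $$ (l, i))"
    using assms by (simp add: mat_adjoint_index mult_mat_index[OF assms] del: index_mult_mat(1))
  also have "\<dots> = (\<Sum>l<m. mat_adjoint B $$ (i, l) * mat_adjoint A $$ (l, j))"
    using assms ij by (auto simp: mat_adjoint_index mult.commute intro!: sum.cong)
  also have "\<dots> = (mat_adjoint B * mat_adjoint A) $$ (i, j)"
    using assms ij by (intro mult_mat_index[symmetric]) auto
  finally show "mat_adjoint (A * B) $$ (i, j) = (mat_adjoint B * mat_adjoint A) $$ (i, j)" .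
qed (use assms in auto)

lemma mat_trace_comm:
  assumes "A \<in> carrier_mat n m" "B \<in> carrier_mat m n"
  shows "mat_trace (A * B) = mat_trace (B * A)"
proof -
  have "mat_trace (A * B) = (\<Sum>i<n. \<Sum>l<m. A $$ (i, l) * B $$ (l, i))"
    using assms by (simp add: mat_trace_def mult_mat_index[OF assms] del: index_mult_mat(1))
  also have "\<dots> = (\<Sum>l<m. \<Sum>i<n. B $$ (l, i) * A $$ (i, l))"
    by (subst sum.swap) (simp add: mult.commute)
  also have "\<dots> = mat_trace (B * A)"
    using assms by (simp add: mat_trace_def mult_mat_index[OF assms(2,1)] del: index_mult_mat(1))
  finally show ?thesis .
qed

definition unitary_mat :: "nat \<Rightarrow> complex mat \<Rightarrow> bool" where
  "unitary_mat n U \<longleftrightarrow> U \<in> carrier_mat n n \<and> mat_adjoint U * U = 1\<^sub>m n \<and> U * mat_adjoint U = 1\<^sub>m n"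

lemma unitary_matI:
  assumes "U \<in> carrier_mat n n" "mat_adjoint U * U = 1\<^sub>m n"
  shows "unitary_mat n U"
  using assms mat_mult_left_right_inverse[of "mat_adjoint U" n U] by (simp add: unitary_mat_def)

lemma unitary_mat_mult:
  assumes "unitary_mat n U" "unitary_mat n V"
  shows "unitary_mat n (U * V)"
proof (rule unitary_matI)
  have [simp]: "U \<in> carrier_mat n n" "V \<in> carrier_mat n n"
    and UU: "mat_adjoint U * U = 1\<^sub>m n" and VV: "mat_adjoint V * V = 1\<^sub>m n"
    using assms by (auto simp: unitary_mat_def)
  note [simp] = mult_carrier_mat[of _ n n _ n]
  show "U * V \<in> carrier_mat n n" by simp
  have "mat_adjoint (U * V) * (U * V) = mat_adjoint V * (mat_adjoint U * (U * V))"
    by (subst mat_adjoint_mult[of U n n V n]) (simp_all add: assoc_mult_mat[of _ n n _ n _ n])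
  also have "mat_adjoint U * (U * V) = mat_adjoint U * U * V"
    by (simp add: assoc_mult_mat[of _ n n _ n _ n])
  finally show "mat_adjoint (U * V) * (U * V) = 1\<^sub>m n"
    by (simp add: UU VV left_mult_one_mat[of V n n])
qed

text \<open>Completing \<open>v\<close> to a basis and running Gram-Schmidt gives orthogonal columns
  that begin with \<open>v\<close> itself. Normalising them makes the matrix unitary, so
  \<open>c\<close> is the reciprocal of the length of \<open>v\<close>.\<close>

lemma unitary_with_first_col:
  assumes v: "v \<in> carrier_vec n" and v0: "v \<noteq> 0\<^sub>v n"
  shows "\<exists>U c. unitary_mat n U \<and> col U 0 = c \<cdot>\<^sub>v v"
proof -
  interpret cof_vec_space n "TYPE(complex)" .
  have n: "n \<noteq> 0" using v v0 by auto
  define b where "b = basis_completion v"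
  define ws where "ws = gram_schmidt n b"
  define W where "W = mat_of_cols n ws"
  from basis_completion[OF v v0, folded b_def]
  have dist_b: "distinct b" and indep: "\<not> lin_dep (set b)" and b: "set b \<subseteq> carrier_vec n"
    and hdb: "hd b = v" and len_b: "length b = n" by auto
  from hdb len_b n obtain vs where bv: "b = v # vs" by (cases b) auto
  from gram_schmidt_result[OF b dist_b indep refl, folded ws_def]
  have ws: "set ws \<subseteq> carrier_vec n" "corthogonal ws" "length ws = n"
    by (auto simp: len_b)
  from gram_schmidt_hd[OF v, of vs, folded bv] have hdws: "hd ws = v" unfolding ws_def .
  have W: "W \<in> carrier_mat n n"
    using ws unfolding W_def using mat_of_cols_carrier(1)[of n ws] by auto
  have colW: "col W j = ws ! j" if "j < n" for j
    using ws that unfolding W_def by (intro col_mat_of_cols) auto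
  \<comment> \<open>The squared length of column \<open>j\<close>: \<open>gram_schmidt\<close>
    orthogonalises without normalising. Since \<open>corthogonal\<close> excludes self-orthogonal
    vectors, \<open>s j\<close> is positive and its root may be divided by.\<close>
  define s where "s j = (\<Sum>i<n. (cmod (W $$ (i, j)))\<^sup>2)" for j
  have ip: "(\<Sum>i<n. W $$ (i, j) * cnj (W $$ (i, k))) = (if j = k then complex_of_real (s j) else 0)"
    and spos: "s j > 0" if "j < n" "k < n" for j k
  proof -
    have eq: "(\<Sum>i<n. W $$ (i, j) * cnj (W $$ (i, k))) = ws ! j \<bullet>c ws ! k"
      if "j < n" "k < n" for j k
      using that W by (simp add: colW[symmetric] scalar_prod_def atLeast0LessThan conjugate_complex_def)
    have sj: "(\<Sum>i<n. W $$ (i, j) * cnj (W $$ (i, j))) = complex_of_real (s j)"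
      by (simp only: s_def of_real_sum complex_norm_square)
    have orth: "(ws ! j \<bullet>c ws ! k = 0) = (j \<noteq> k)" if "j < n" "k < n" for j k
      using ws(2,3) that by (auto simp: corthogonal_def)
    show "(\<Sum>i<n. W $$ (i, j) * cnj (W $$ (i, k))) = (if j = k then complex_of_real (s j) else 0)"
      using sj eq[OF that] orth[OF that] by auto
    have "s j \<noteq> 0"
      using sj eq[of j j] orth[of j j] that by auto
    moreover have "s j \<ge> 0" by (simp add: s_def sum_nonneg)
    ultimately show "s j > 0" by simp
  qed
  define U where "U = mat n n (\<lambda>(i, j). W $$ (i, j) / complex_of_real (sqrt (s j)))"
  have U: "U \<in> carrier_mat n n" by (simp add: U_def)
  have "mat_adjoint U * U = 1\<^sub>m n"
  proof (rule eq_matI)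
    fix i j assume "i < dim_row (1\<^sub>m n :: complex mat)" "j < dim_col (1\<^sub>m n :: complex mat)"
    then have ij: "i < n" "j < n" by auto
    have "(mat_adjoint U * U) $$ (i, j) = (\<Sum>l<n. mat_adjoint U $$ (i, l) * U $$ (l, j))"
      using U ij by (intro mult_mat_index) auto
    also have "\<dots> = (\<Sum>l<n. W $$ (l, j) * cnj (W $$ (l, i)))
                       / complex_of_real (sqrt (s i) * sqrt (s j))"
      unfolding sum_divide_distrib using ij U
      by (intro sum.cong) (auto simp: mat_adjoint_index U_def)
    also have "\<dots> = (if i = j then 1 else 0)"
      using ij spos[OF ij]
      by (cases "i = j") (auto simp: ip simp flip: of_real_mult)
    finally show "(mat_adjoint U * U) $$ (i, j) = 1\<^sub>m n $$ (i, j)" using ij by simp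
  qed (use U in auto)
  moreover have "col U 0 = (1 / complex_of_real (sqrt (s 0))) \<cdot>\<^sub>v v"
  proof -
    have "v = col W 0" using colW[of 0] hdws n ws(3) by (cases ws) auto
    then show ?thesis using n W by (intro eq_vecI) (auto simp: U_def)
  qed
  ultimately show ?thesis using unitary_matI[OF U] by blast
qed

text \<open>Deflation by induction on the dimension: in a unitary basis that starts with an
  eigenvector, the first column of A vanishes below the diagonal. Hermiticity then clears the first
  row as well, and the remaining block is Hermitian of size \<open>n\<close>.\<close>

lemma hermitian_unitarily_diagonalizable:
  assumes "A \<in> carrier_mat n n" "mat_adjoint A = A"
  shows "\<exists>U (\<mu> :: nat \<Rightarrow> real). unitary_mat n U \<and>
    A = U * mat n n (\<lambda>(i, j). if i = j then complex_of_real (\<mu> i) else 0) * mat_adjoint U"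
  using assms
proof (induction n arbitrary: A)
  case 0
  then show ?case by (intro exI[of _ A]) (auto simp: unitary_mat_def intro!: eq_matI)
next
  case (Suc n)
  let ?N = "Suc n"
  have A: "A \<in> carrier_mat ?N ?N" by fact
  have "degree (char_poly A) \<noteq> 0" using degree_monic_char_poly[OF A] by simp
  then obtain e where "poly (char_poly A) e = 0"
    using fundamental_theorem_of_algebra_alt[of "char_poly A"] by (metis degree_pCons_0)
  then have "eigenvalue A e" using eigenvalue_root_char_poly[OF A] by simp
  then obtain v where v: "v \<in> carrier_vec ?N" "v \<noteq> 0\<^sub>v ?N" and ev: "A *\<^sub>v v = e \<cdot>\<^sub>v v"
    using A by (auto simp: eigenvalue_def eigenvector_def)
  obtain U c where UU: "unitary_mat ?N U" and col0: "col U 0 = c \<cdot>\<^sub>v v"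
    using unitary_with_first_col[OF v] by blast
  have U [simp]: "U \<in> carrier_mat ?N ?N" and U1: "mat_adjoint U * U = 1\<^sub>m ?N"
    and U2: "U * mat_adjoint U = 1\<^sub>m ?N" using UU by (auto simp: unitary_mat_def)
  note [simp] = A mult_carrier_mat[of _ ?N ?N _ ?N]
  note asc = assoc_mult_mat[of _ ?N ?N _ ?N _ ?N]
  define B where "B = mat_adjoint U * (A * U)"
  have B: "B \<in> carrier_mat ?N ?N" unfolding B_def by (intro mult_carrier_mat[of _ ?N ?N] mat_adjoint_carrier U A)
  have Bh: "mat_adjoint B = B"
    unfolding B_def by (simp add: mat_adjoint_mult[of _ ?N ?N _ ?N] Suc.prems(2) asc)
  have Bi0: "B $$ (i, 0) = (if i = 0 then e else 0)" if "i < ?N" for i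
  proof -
    have "A *\<^sub>v col U 0 = e \<cdot>\<^sub>v col U 0"
      unfolding col0 mult_mat_vec[OF A v(1)] ev by (simp add: smult_smult_assoc mult.commute)
    then have col: "col (A * U) 0 = e \<cdot>\<^sub>v col U 0" using col_mult2[OF A U, of 0] by simp
    have "B $$ (i, 0) = row (mat_adjoint U) i \<bullet> col (A * U) 0"
      using that unfolding B_def by (intro index_mult_mat) (simp_all add: carrier_matD[OF U])
    also have "\<dots> = e * (row (mat_adjoint U) i \<bullet> col U 0)"
      unfolding col using that
      by (intro scalar_prod_smult_distrib[of _ ?N]) (simp_all add: carrier_vecI carrier_matD[OF U])
    also have "\<dots> = e * (mat_adjoint U * U) $$ (i, 0)"
      using that by (subst index_mult_mat) (simp_all add: carrier_matD[OF U])
    finally have "B $$ (i, 0) = e * (mat_adjoint U * U) $$ (i, 0)" .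
    then show ?thesis using that by (simp add: U1)
  qed
  have B0j: "B $$ (0, j) = (if j = 0 then cnj e else 0)" if "j < ?N" for j
  proof -
    have "B $$ (0, j) = mat_adjoint B $$ (0, j)" by (simp add: Bh)
    also have "\<dots> = cnj (B $$ (j, 0))" using B that by (intro mat_adjoint_index) auto
    finally show ?thesis using Bi0[OF that] by simp
  qed
  \<comment> \<open>The corner entry equals both \<open>e\<close> and its conjugate, so the
    eigenvalue is real.\<close>
  from Bi0[of 0] B0j[of 0] have er: "complex_of_real (Re e) = e"
    by (simp add: complex_eq_iff)
  then have ecnj: "cnj e = e" by (metis complex_cnj_complex_of_real)
  define C where "C = mat n n (\<lambda>(i, j). B $$ (Suc i, Suc j))"
  have C: "C \<in> carrier_mat n n" by (simp add: C_def)
  have "mat_adjoint C = C"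
  proof (rule eq_matI)
    fix i j assume "i < dim_row C" "j < dim_col C"
    then have ij: "i < n" "j < n" by (auto simp: C_def)
    have "mat_adjoint C $$ (i, j) = cnj (B $$ (Suc j, Suc i))"
      using ij C by (subst mat_adjoint_index) (auto simp: C_def)
    also have "\<dots> = mat_adjoint B $$ (Suc i, Suc j)"
      using B ij by (intro mat_adjoint_index[symmetric]) auto
    finally show "mat_adjoint C $$ (i, j) = C $$ (i, j)" using ij by (simp add: Bh C_def)
  qed (use C in auto)
  then obtain V \<mu> where VU: "unitary_mat n V" and CV:
    "C = V * mat n n (\<lambda>(i, j). if i = j then complex_of_real (\<mu> i) else 0) * mat_adjoint V"
    using Suc.IH[OF C] by blast
  have V: "V \<in> carrier_mat n n" and V1: "mat_adjoint V * V = 1\<^sub>m n" using VU by (auto simp: unitary_mat_def)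
  let ?D = "mat n n (\<lambda>(i, j). if i = j then complex_of_real (\<mu> i) else 0)"
  let ?E = "mat 1 1 (\<lambda>_. e)"
  let ?bl = "\<lambda>X Y. four_block_mat X (0\<^sub>m 1 n) (0\<^sub>m n 1) Y"
  \<comment> \<open>The diagonaliser of the lower block is extended by 1 in the corner, and
    \<open>\<nu>\<close> correspondingly puts the split-off eigenvalue in front of
    \<open>\<mu>\<close>.\<close>
  define F where "F = ?bl (1\<^sub>m 1) V"
  define \<nu> where "\<nu> = case_nat (Re e) \<mu>"
  let ?D' = "mat ?N ?N (\<lambda>(i, j). if i = j then complex_of_real (\<nu> i) else 0)"
  have F [simp]: "F \<in> carrier_mat ?N ?N"
    using four_block_carrier_mat[of "1\<^sub>m 1" 1 1 V n n "0\<^sub>m 1 n" "0\<^sub>m n 1"] V by (simp add: F_def)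
  have Fa: "mat_adjoint F = ?bl (1\<^sub>m 1) (mat_adjoint V)"
    using V F by (intro eq_matI) (auto simp: mat_adjoint_index F_def)
  have D': "?D' = ?bl ?E ?D"
    using er by (intro eq_matI) (auto simp: \<nu>_def split: nat.splits)
  have BB: "B = ?bl ?E C"
    using B Bi0 B0j ecnj by (intro eq_matI) (auto simp: C_def split: nat.splits)
  have FF: "unitary_mat ?N F"
  proof (rule unitary_matI[OF F])
    have "mat_adjoint F * F = ?bl (1\<^sub>m 1) (1\<^sub>m n)"
      unfolding Fa unfolding F_def
      using V V1 by (subst mult_four_block_mat[of _ 1 1 _ n _ n _ _ 1 _ n]) auto
    then show "mat_adjoint F * F = 1\<^sub>m ?N" by simp
  qed
  have FDF: "F * ?D' * mat_adjoint F = B"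
  proof -
    have "F * ?D' = ?bl ?E (V * ?D)"
      unfolding D' F_def using V
      by (subst mult_four_block_mat[of _ 1 1 _ n _ n _ _ 1 _ n]) auto
    then show ?thesis
      unfolding Fa BB CV using V
      by (simp, subst mult_four_block_mat[of _ 1 1 _ n _ n _ _ 1 _ n]) auto
  qed
  have "A = (U * mat_adjoint U) * A * (U * mat_adjoint U)"
    by (simp add: U2 left_mult_one_mat[OF A] right_mult_one_mat[OF A])
  also have "\<dots> = U * B * mat_adjoint U"
    unfolding B_def by (simp add: asc)
  also have "\<dots> = (U * F) * ?D' * mat_adjoint (U * F)"
    unfolding FDF[symmetric] by (simp add: asc mat_adjoint_mult[of _ ?N ?N _ ?N])
  finally show ?case using unitary_mat_mult[OF UU FF] by blast
qed

text \<open>This is A = sum_l \<mu>_l u_l u_l^dag written entrywise, with eigenvectors as plain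
  functions of an index. Later arguments then reduce to exchanging finite sums.\<close>

definition spectral_decomp :: "nat \<Rightarrow> complex mat \<Rightarrow> (nat \<Rightarrow> nat \<Rightarrow> complex) \<Rightarrow> (nat \<Rightarrow> real) \<Rightarrow> bool" where
  "spectral_decomp n A u \<mu> \<longleftrightarrow>
    (\<forall>l<n. \<forall>m<n. (\<Sum>i<n. cnj (u l i) * u m i) = (if l = m then 1 else 0)) \<and>
    (\<forall>i<n. \<forall>j<n. A $$ (i, j) = (\<Sum>l<n. of_real (\<mu> l) * (u l i * cnj (u l j))))"

lemma spectral_decompD:
  assumes "spectral_decomp n A u \<mu>"
  shows "l < n \<Longrightarrow> m < n \<Longrightarrow> (\<Sum>i<n. cnj (u l i) * u m i) = (if l = m then 1 else 0)"
    and "i < n \<Longrightarrow> j < n \<Longrightarrow> A $$ (i, j) = (\<Sum>l<n. of_real (\<mu> l) * (u l i * cnj (u l j)))"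
  using assms unfolding spectral_decomp_def by blast+

text \<open>For Hermitian A the matrix A^dag A is A * A, which is unitarily similar to the diagonal
  matrix of the \<mu>_l^2. Its characteristic polynomial therefore splits with the right
  multiplicities, and the singular values are the |\<mu>_l|.\<close>

lemma hermitian_spectral_decomp:
  assumes A: "A \<in> carrier_mat n n" and h: "mat_adjoint A = A"
  shows "\<exists>u \<mu>. spectral_decomp n A u \<mu> \<and> trace_norm A = (\<Sum>l<n. \<bar>\<mu> l\<bar>)"
proof -
  obtain U \<mu> where UU: "unitary_mat n U"
    and AU: "A = U * mat n n (\<lambda>(i, j). if i = j then complex_of_real (\<mu> i) else 0) * mat_adjoint U"
    using hermitian_unitarily_diagonalizable[OF assms] by blast
  define D where "D = mat n n (\<lambda>(i, j). if i = j then complex_of_real (\<mu> i) else 0)"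
  have D: "D \<in> carrier_mat n n" by (simp add: D_def)
  have U: "U \<in> carrier_mat n n" and U1: "mat_adjoint U * U = 1\<^sub>m n" and U2: "U * mat_adjoint U = 1\<^sub>m n"
    using UU by (auto simp: unitary_mat_def)
  have Ua: "mat_adjoint U \<in> carrier_mat n n" using U by simp
  define u where "u l i = U $$ (i, l)" for l i
  have ortho: "(\<Sum>i<n. cnj (u l i) * u m i) = (if l = m then 1 else 0)" if "l < n" "m < n" for l m
  proof -
    have "(mat_adjoint U * U) $$ (l, m) = (\<Sum>i<n. cnj (u l i) * u m i)"
      using that U by (simp add: mult_mat_index[OF Ua U] mat_adjoint_index u_def del: index_mult_mat(1))
    then show ?thesis using that by (simp add: U1)
  qed
  have ent: "A $$ (i, j) = (\<Sum>l<n. of_real (\<mu> l) * (u l i * cnj (u l j)))" if "i < n" "j < n" for i j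
  proof -
    have UD: "(U * D) $$ (i, l) = U $$ (i, l) * of_real (\<mu> l)" if "l < n" for l
    proof -
      have "(U * D) $$ (i, l) = (\<Sum>k<n. U $$ (i, k) * D $$ (k, l))"
        using mult_mat_index[OF U D \<open>i < n\<close> that] .
      also have "\<dots> = (\<Sum>k<n. if k = l then U $$ (i, l) * of_real (\<mu> l) else 0)"
        using that by (intro sum.cong) (auto simp: D_def)
      finally show ?thesis using that by simp
    qed
    have "A $$ (i, j) = (\<Sum>l<n. (U * D) $$ (i, l) * mat_adjoint U $$ (l, j))"
      unfolding AU D_def[symmetric] using mult_mat_index[OF mult_carrier_mat[OF U D] Ua that] .
    then show ?thesis
      using that U by (simp add: UD mat_adjoint_index u_def mult_ac del: index_mult_mat(1))
  qed
  have DD: "D * D = mat n n (\<lambda>(i, j). if i = j then complex_of_real ((\<mu> i)\<^sup>2) else 0)" (is "_ = ?D2")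
  proof (rule eq_matI)
    fix i j assume "i < dim_row ?D2" "j < dim_col ?D2"
    then have ij: "i < n" "j < n" by auto
    have "(D * D) $$ (i, j) = (\<Sum>k<n. D $$ (i, k) * D $$ (k, j))"
      using mult_mat_index[OF D D ij] .
    also have "\<dots> = (\<Sum>k<n. if k = i then (if i = j then complex_of_real ((\<mu> i)\<^sup>2) else 0) else 0)"
      using ij by (intro sum.cong) (auto simp: D_def power2_eq_square)
    finally show "(D * D) $$ (i, j) = ?D2 $$ (i, j)" using ij by simp
  qed (use D in auto)
  have sim: "similar_mat (A * A) (D * D)"
    unfolding similar_mat_def
  proof (intro exI)
    have "A * A = U * D * (mat_adjoint U * U) * D * mat_adjoint U"
      unfolding AU D_def[symmetric]
      using U D Ua by (simp add: mult_carrier_mat[of _ n n _ n] assoc_mult_mat[of _ n n _ n _ n])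
    also have "\<dots> = U * (D * D) * mat_adjoint U"
      using U D Ua by (simp add: U1 mult_carrier_mat[of _ n n _ n] left_mult_one_mat[OF mult_carrier_mat[OF D Ua]] assoc_mult_mat[of _ n n _ n _ n])
    finally show "similar_mat_wit (A * A) (D * D) U (mat_adjoint U)"
      using A D U Ua U1 U2 by (intro similar_mat_witI[of _ _ n]) auto
  qed
  have D2: "D * D \<in> carrier_mat n n" using D by auto
  have "char_poly (A * A) = char_poly (D * D)" by (rule char_poly_similar[OF sim])
  also have "\<dots> = (\<Prod>a\<leftarrow>diag_mat (D * D). [:- a, 1:])"
    using D2 by (rule char_poly_upper_triangular) (auto simp: DD upper_triangular_def)
  also have "diag_mat (D * D) = map (\<lambda>l. complex_of_real ((\<mu> l)\<^sup>2)) [0..<n]"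
    by (auto simp: DD diag_mat_def)
  finally have cp: "char_poly (A * A) = (\<Prod>l<n. [:- complex_of_real ((\<mu> l)\<^sup>2), 1:])"
    by (simp add: prod.list_conv_set_nth atLeast0LessThan)
  have pr: "proots (char_poly (A * A)) = (\<Sum>l<n. {#complex_of_real ((\<mu> l)\<^sup>2)#})"
    unfolding cp by (subst proots_prod) auto
  have "trace_norm A = (\<Sum>s\<in>#(\<Sum>l<n. {#complex_of_real ((\<mu> l)\<^sup>2)#}). sqrt (Re s))"
    unfolding trace_norm_def h pr ..
  also have "\<dots> = (\<Sum>l<n. \<bar>\<mu> l\<bar>)"
    by (induction n) auto
  finally show ?thesis using ortho ent unfolding spectral_decomp_def by blast
qed

text \<open>Expresses an eigenvalue as a value of the quadratic form, so that positivity of the form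
  passes to the eigenvalues.\<close>

lemma spectral_decomp_eigenvalue:
  assumes "spectral_decomp n A u \<mu>" "l < n"
  shows "(\<Sum>i<n. \<Sum>j<n. cnj (u l i) * A $$ (i, j) * u l j) = of_real (\<mu> l)"
proof -
  note orth = spectral_decompD(1)[OF assms(1)] and ent = spectral_decompD(2)[OF assms(1)]
  have inner: "(\<Sum>j<n. A $$ (i, j) * u l j) = of_real (\<mu> l) * u l i" if "i < n" for i
  proof -
    have "(\<Sum>j<n. A $$ (i, j) * u l j)
        = (\<Sum>j<n. \<Sum>m<n. of_real (\<mu> m) * u m i * (cnj (u m j) * u l j))"
      using that by (intro sum.cong refl) (simp add: ent sum_distrib_right sum_distrib_left mult_ac)
    also have "\<dots> = (\<Sum>m<n. of_real (\<mu> m) * u m i * (\<Sum>j<n. cnj (u m j) * u l j))"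
      by (subst sum.swap) (simp only: sum_distrib_left)
    also have "\<dots> = (\<Sum>m<n. if m = l then of_real (\<mu> l) * u l i else 0)"
      using \<open>l < n\<close> by (intro sum.cong refl) (simp add: orth)
    finally show ?thesis using \<open>l < n\<close> by simp
  qed
  have "(\<Sum>i<n. \<Sum>j<n. cnj (u l i) * A $$ (i, j) * u l j) = (\<Sum>i<n. cnj (u l i) * (\<Sum>j<n. A $$ (i, j) * u l j))"
    by (simp add: sum_distrib_left mult.assoc)
  also have "\<dots> = (\<Sum>i<n. of_real (\<mu> l) * (cnj (u l i) * u l i))"
    by (intro sum.cong refl) (simp add: inner)
  also have "\<dots> = of_real (\<mu> l)"
    using assms(2) by (simp add: sum_distrib_left[symmetric] orth)
  finally show ?thesis .
qed

lemma psd_quadratic_form: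
  assumes "psd d A"
  shows "0 \<le> (\<Sum>i<d. \<Sum>j<d. A $$ (i, j) * f j * cnj (f i))"
proof -
  have A: "A \<in> carrier_mat d d" using assms by (simp add: psd_def)
  have "(A *\<^sub>v vec d f) \<bullet>c vec d f = (\<Sum>i<d. \<Sum>j<d. A $$ (i, j) * f j * cnj (f i))"
    using A by (simp add: scalar_prod_def atLeast0LessThan sum_distrib_right conjugate_complex_def)
  then show ?thesis using assms unfolding psd_def by (metis vec_carrier)
qed

text \<open>Positivity of a complex quadratic form includes that its values are real, and
  polarisation turns this into Hermiticity.\<close>

lemma psd_hermitian:
  assumes "psd d A"
  shows "mat_adjoint A = A"
proof -
  have A: "A \<in> carrier_mat d d" using assms by (simp add: psd_def)
  have two: "Im (cnj x * x * A $$ (a, a) + cnj x * y * A $$ (a, b)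
      + (cnj y * x * A $$ (b, a) + cnj y * y * A $$ (b, b))) = 0"
    if "a < d" "b < d" for a b x y
  proof -
    \<comment> \<open>The test vector x e_a + y e_b. Writing it as a sum of two conditionals keeps
      the case a = b valid.\<close>
    let ?f = "\<lambda>k. (if k = a then x else 0) + (if k = b then y else 0)"
    have "(\<Sum>i<d. \<Sum>j<d. A $$ (i, j) * ?f j * cnj (?f i))
        = (\<Sum>i<d. cnj (?f i) * (\<Sum>j<d. A $$ (i, j) * ?f j))"
      by (simp only: sum_distrib_left mult_ac)
    also have "\<dots> = (\<Sum>i<d. cnj (?f i) * (A $$ (i, a) * x + A $$ (i, b) * y))"
      using that by (simp add: distrib_left sum.distrib if_distrib[of "(*) _"] cong: if_cong)
    also have "\<dots> = (\<Sum>i<d. (if i = a then cnj x * (A $$ (i, a) * x + A $$ (i, b) * y) else 0)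
        + (if i = b then cnj y * (A $$ (i, a) * x + A $$ (i, b) * y) else 0))"
      by (intro sum.cong) (auto simp: distrib_right)
    also have "\<dots> = cnj x * (A $$ (a, a) * x + A $$ (a, b) * y)
        + cnj y * (A $$ (b, a) * x + A $$ (b, b) * y)"
      using that by (simp add: sum.distrib)
    finally show ?thesis
      using psd_quadratic_form[OF assms, of ?f] by (simp add: less_eq_complex_def algebra_simps)
  qed
  have "cnj (A $$ (b, a)) = A $$ (a, b)" if "a < d" "b < d" for a b
    \<comment> \<open>The first two choices make the diagonal entries real. Then (1, 1) makes the
      imaginary parts of the off-diagonal pair opposite, and (1, i) makes their real parts
      equal.\<close>
    using two[OF that, of 1 0] two[OF that, of 0 1] two[OF that, of 1 1] two[OF that, of 1 \<i>]
    by (simp add: complex_eq_iff)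
  then show ?thesis using A by (intro eq_matI) (auto simp: mat_adjoint_index)
qed

section \<open>Sums of quadratic forms and the trace norm\<close>

text \<open>The standard inner product, conjugate-linear in the first argument; only indices below
  \<open>n\<close> count.\<close>

definition cip :: "nat \<Rightarrow> (nat \<Rightarrow> complex) \<Rightarrow> (nat \<Rightarrow> complex) \<Rightarrow> complex" where
  "cip n e v = (\<Sum>i<n. cnj (e i) * v i)"

lemma cip_commute: "cip n v e = cnj (cip n e v)"
  by (simp add: cip_def mult.commute)

lemma cmod_cip_sq: "complex_of_real ((cmod (cip n e v))\<^sup>2) = (\<Sum>i<n. \<Sum>j<n. cnj (e i) * (v i * cnj (v j)) * e j)"
proof -
  have "complex_of_real ((cmod (cip n e v))\<^sup>2) = cip n e v * cip n v e"
    by (simp only: complex_norm_square cip_commute[of n v e])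
  also have "\<dots> = (\<Sum>i<n. \<Sum>j<n. cnj (e i) * (v i * cnj (v j)) * e j)"
    unfolding cip_def sum_product by (simp only: mult_ac)
  finally show ?thesis .
qed

lemma cip_self: "cip n v v = complex_of_real (\<Sum>i<n. (cmod (v i))\<^sup>2)"
  by (simp only: cip_def of_real_sum complex_norm_square mult.commute)

lemma cip_Cauchy_Schwarz:
  "(cmod (cip n e v))\<^sup>2 \<le> (\<Sum>i<n. (cmod (e i))\<^sup>2) * (\<Sum>i<n. (cmod (v i))\<^sup>2)"
proof -
  have "cmod (cip n e v) \<le> (\<Sum>i<n. \<bar>cmod (e i)\<bar> * \<bar>cmod (v i)\<bar>)"
    unfolding cip_def by (rule order_trans[OF norm_sum]) (simp add: norm_mult)
  also have "\<dots> \<le> L2_set (\<lambda>i. cmod (e i)) {..<n} * L2_set (\<lambda>i. cmod (v i)) {..<n}"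
    by (rule L2_set_mult_ineq)
  finally have "(cmod (cip n e v))\<^sup>2 \<le> (L2_set (\<lambda>i. cmod (e i)) {..<n} * L2_set (\<lambda>i. cmod (v i)) {..<n})\<^sup>2"
    by (intro power_mono) auto
  then show ?thesis by (simp add: power_mult_distrib L2_set_def sum_nonneg)
qed

definition quad_sum :: "nat \<Rightarrow> (nat \<Rightarrow> complex) list \<Rightarrow> complex mat \<Rightarrow> complex" where
  "quad_sum n es Y = (\<Sum>e\<leftarrow>es. \<Sum>i<n. \<Sum>j<n. cnj (e i) * Y $$ (i, j) * e j)"

text \<open>With \<open>t\<^sub>l = \<Sum>\<^sub>e \<bar>\<langle>e, u\<^sub>l\<rangle>\<bar>\<^sup>2 \<in> [0, 1]\<close> for the eigenbasis \<open>u\<close> of \<open>Y\<close>, the quadratic sum is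
  \<open>\<Sum>\<^sub>l \<mu>\<^sub>l t\<^sub>l\<close>.\<close>

lemma quad_sum_trace_norm:
  assumes Y: "Y \<in> carrier_mat n n" and h: "mat_adjoint Y = Y"
    and contr: "\<And>v. (\<Sum>e\<leftarrow>es. (cmod (cip n e v))\<^sup>2) \<le> (\<Sum>i<n. (cmod (v i))\<^sup>2)"
  shows "\<bar>Re (quad_sum n es Y)\<bar> \<le> trace_norm Y"
    and "\<bar>2 * Re (quad_sum n es Y) - Re (mat_trace Y)\<bar> \<le> trace_norm Y"
proof -
  obtain u \<mu> where sd: "spectral_decomp n Y u \<mu>" and tn: "trace_norm Y = (\<Sum>l<n. \<bar>\<mu> l\<bar>)"
    using hermitian_spectral_decomp[OF Y h] by blast
  note orth = spectral_decompD(1)[OF sd] and ent = spectral_decompD(2)[OF sd]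
  define t where "t l = (\<Sum>e\<leftarrow>es. (cmod (cip n e (u l)))\<^sup>2)" for l
  have nrm: "(\<Sum>i<n. (cmod (u l i))\<^sup>2) = 1" if "l < n" for l
    using orth[OF that that] cip_self[of n "u l"] unfolding cip_def by (simp flip: of_real_sum of_real_power)
  have t: "0 \<le> t l" "t l \<le> 1" if "l < n" for l
    using contr[of "u l"] nrm[OF that] by (auto simp: t_def intro!: sum_list_nonneg)
  have one: "(\<Sum>i<n. \<Sum>j<n. cnj (e i) * Y $$ (i, j) * e j)
      = complex_of_real (\<Sum>l<n. \<mu> l * (cmod (cip n e (u l)))\<^sup>2)" for e
  proof -
    have "(\<Sum>i<n. \<Sum>j<n. cnj (e i) * Y $$ (i, j) * e j)
      = (\<Sum>i<n. \<Sum>j<n. \<Sum>l<n. of_real (\<mu> l) * (cnj (e i) * (u l i * cnj (u l j)) * e j))"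
      by (intro sum.cong refl) (simp add: ent sum_distrib_left sum_distrib_right mult_ac)
    also have "\<dots> = (\<Sum>i<n. \<Sum>l<n. \<Sum>j<n. of_real (\<mu> l) * (cnj (e i) * (u l i * cnj (u l j)) * e j))"
      by (intro sum.cong refl sum.swap)
    also have "\<dots> = (\<Sum>l<n. \<Sum>i<n. \<Sum>j<n. of_real (\<mu> l) * (cnj (e i) * (u l i * cnj (u l j)) * e j))"
      by (rule sum.swap)
    also have "\<dots> = (\<Sum>l<n. of_real (\<mu> l) * complex_of_real ((cmod (cip n e (u l)))\<^sup>2))"
      unfolding cmod_cip_sq by (simp only: sum_distrib_left)
    finally show ?thesis by simp
  qed
  have q: "Re (quad_sum n es Y) = (\<Sum>l<n. \<mu> l * t l)"
  proof -
    have "quad_sum n es Y = complex_of_real (\<Sum>l<n. \<mu> l * t l)"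
      unfolding quad_sum_def one t_def
      by (induction es) (auto simp: distrib_left sum.distrib)
    then show ?thesis by simp
  qed
  have tr: "Re (mat_trace Y) = (\<Sum>l<n. \<mu> l)"
  proof -
    have "mat_trace Y = (\<Sum>i<n. \<Sum>l<n. of_real (\<mu> l) * (u l i * cnj (u l i)))"
      using Y by (simp add: mat_trace_def ent)
    also have "\<dots> = (\<Sum>l<n. of_real (\<mu> l) * (\<Sum>i<n. cnj (u l i) * u l i))"
      by (subst sum.swap) (simp add: sum_distrib_left mult_ac)
    also have "\<dots> = complex_of_real (\<Sum>l<n. \<mu> l)"
      by (simp add: orth)
    finally show ?thesis by simp
  qed
  have "\<bar>\<Sum>l<n. \<mu> l * t l\<bar> \<le> (\<Sum>l<n. \<bar>\<mu> l * t l\<bar>)" by (rule sum_abs)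
  also have "\<dots> \<le> (\<Sum>l<n. \<bar>\<mu> l\<bar>)"
    using t by (intro sum_mono) (auto simp: abs_mult intro!: mult_left_le)
  finally show "\<bar>Re (quad_sum n es Y)\<bar> \<le> trace_norm Y" unfolding q tn .
  \<comment> \<open>Since the trace is the sum of the eigenvalues, it shifts each weight 2 t_l by
    -1. The new weights lie in [-1, 1] because t_l lies in [0, 1].\<close>
  have "2 * Re (quad_sum n es Y) - Re (mat_trace Y) = (\<Sum>l<n. \<mu> l * (2 * t l - 1))"
    unfolding q tr by (simp add: algebra_simps sum_subtractf sum_distrib_left)
  also have "\<bar>\<dots>\<bar> \<le> (\<Sum>l<n. \<bar>\<mu> l * (2 * t l - 1)\<bar>)" by (rule sum_abs)
  also have "\<dots> \<le> (\<Sum>l<n. \<bar>\<mu> l\<bar>)"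
  proof (intro sum_mono)
    fix l assume "l \<in> {..<n}"
    then have "\<bar>2 * t l - 1\<bar> \<le> 1" using t[of l] by simp
    then show "\<bar>\<mu> l * (2 * t l - 1)\<bar> \<le> \<bar>\<mu> l\<bar>" unfolding abs_mult by (intro mult_left_le) auto
  qed
  finally show "\<bar>2 * Re (quad_sum n es Y) - Re (mat_trace Y)\<bar> \<le> trace_norm Y" unfolding tn .
qed

section \<open>Positive operators as sums of rank-one projections onto unnormalised vectors\<close>

definition gram :: "nat \<Rightarrow> (nat \<Rightarrow> complex) list \<Rightarrow> complex mat" where
  "gram n gs = mat n n (\<lambda>(i, j). \<Sum>g\<leftarrow>gs. g i * cnj (g j))"

lemma gram_carrier [simp]: "gram n gs \<in> carrier_mat n n"
  and gram_dim [simp]: "dim_row (gram n gs) = n" "dim_col (gram n gs) = n"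
  by (simp_all add: gram_def)

lemma cnj_sum_list: "cnj (sum_list xs) = sum_list (map cnj xs)"
  by (induction xs) auto

lemma gram_hermitian: "mat_adjoint (gram n gs) = gram n gs"
  by (intro eq_matI) (auto simp: mat_adjoint_index gram_def cnj_sum_list o_def mult.commute)

lemma quad_sum_gram:
  "quad_sum n es (gram n gs) = complex_of_real (\<Sum>e\<leftarrow>es. \<Sum>g\<leftarrow>gs. (cmod (cip n e g))\<^sup>2)"
proof -
  have "(\<Sum>i<n. \<Sum>j<n. cnj (e i) * gram n gs $$ (i, j) * e j)
      = complex_of_real (\<Sum>g\<leftarrow>gs. (cmod (cip n e g))\<^sup>2)" for e
  proof (induction gs)
    case Nil
    then show ?case by (simp add: gram_def)
  next
    case (Cons g gs)
    have "(\<Sum>i<n. \<Sum>j<n. cnj (e i) * gram n (g # gs) $$ (i, j) * e j)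
      = (\<Sum>i<n. \<Sum>j<n. cnj (e i) * (g i * cnj (g j)) * e j)
        + (\<Sum>i<n. \<Sum>j<n. cnj (e i) * gram n gs $$ (i, j) * e j)"
      unfolding sum.distrib[symmetric]
      by (intro sum.cong refl) (simp add: gram_def distrib_left distrib_right)
    then show ?case unfolding Cons cmod_cip_sq[symmetric] by simp
  qed
  then show ?thesis unfolding quad_sum_def by (induction es) auto
qed

lemma quad_sum_minus:
  assumes "Y \<in> carrier_mat n n" "Z \<in> carrier_mat n n"
  shows "quad_sum n es (Y - Z) = quad_sum n es Y - quad_sum n es Z"
proof -
  have "(\<Sum>i<n. \<Sum>j<n. cnj (e i) * (Y - Z) $$ (i, j) * e j)
      = (\<Sum>i<n. \<Sum>j<n. cnj (e i) * Y $$ (i, j) * e j) - (\<Sum>i<n. \<Sum>j<n. cnj (e i) * Z $$ (i, j) * e j)" for e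
    unfolding sum_subtractf[symmetric] using assms
    by (intro sum.cong refl) (simp add: algebra_simps)
  then show ?thesis unfolding quad_sum_def by (induction es) auto
qed

lemma mat_trace_gram: "mat_trace (gram n gs) = complex_of_real (\<Sum>g\<leftarrow>gs. \<Sum>i<n. (cmod (g i))\<^sup>2)"
proof (induction gs)
  case Nil
  then show ?case by (simp add: mat_trace_def gram_def)
next
  case (Cons g gs)
  have "mat_trace (gram n (g # gs)) = cip n g g + mat_trace (gram n gs)"
    by (simp add: mat_trace_def gram_def cip_def sum.distrib mult.commute)
  then show ?case unfolding Cons cip_self by simp
qed

text \<open>The quadratic form of a Gram matrix is a sum of squared moduli, so every eigenvalue is
  nonnegative and the trace norm equals the trace.\<close>

lemma trace_norm_gram: "trace_norm (gram n gs) = (\<Sum>g\<leftarrow>gs. \<Sum>i<n. (cmod (g i))\<^sup>2)"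
proof -
  obtain u \<mu> where sd: "spectral_decomp n (gram n gs) u \<mu>" and tn: "trace_norm (gram n gs) = (\<Sum>l<n. \<bar>\<mu> l\<bar>)"
    using hermitian_spectral_decomp[OF gram_carrier gram_hermitian] by blast
  note orth = spectral_decompD(1)[OF sd] and ent = spectral_decompD(2)[OF sd] and quad = spectral_decomp_eigenvalue[OF sd]
  have "\<mu> l \<ge> 0" if "l < n" for l
  proof -
    have "\<mu> l = Re (quad_sum n [u l] (gram n gs))" using quad[OF that] by (simp add: quad_sum_def)
    also have "\<dots> \<ge> 0" unfolding quad_sum_gram by (auto intro!: sum_list_nonneg)
    finally show ?thesis .
  qed
  then have "trace_norm (gram n gs) = (\<Sum>l<n. \<mu> l)" unfolding tn by simp
  moreover have "mat_trace (gram n gs) = complex_of_real (\<Sum>l<n. \<mu> l)"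
  proof -
    have "mat_trace (gram n gs) = (\<Sum>i<n. \<Sum>l<n. of_real (\<mu> l) * (u l i * cnj (u l i)))"
      by (simp add: mat_trace_def ent)
    also have "\<dots> = (\<Sum>l<n. of_real (\<mu> l) * (\<Sum>i<n. cnj (u l i) * u l i))"
      by (subst sum.swap) (simp add: sum_distrib_left mult_ac)
    finally show ?thesis by (simp add: orth)
  qed
  ultimately show ?thesis unfolding mat_trace_gram by (simp only: of_real_eq_iff)
qed

text \<open>The factor has the eigenvectors as columns, column l scaled by the root of \<mu>_l,
  where positivity ensures \<mu>_l \<ge> 0.\<close>

lemma psd_square_root:
  assumes "psd d \<rho>"
  obtains A where "A \<in> carrier_mat d d" "A * mat_adjoint A = \<rho>"
proof -
  have \<rho>: "\<rho> \<in> carrier_mat d d" using assms by (simp add: psd_def)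
  obtain u \<mu> where sd: "spectral_decomp d \<rho> u \<mu>"
    using hermitian_spectral_decomp[OF \<rho> psd_hermitian[OF assms]] by blast
  note orth = spectral_decompD(1)[OF sd] and ent = spectral_decompD(2)[OF sd] and quad = spectral_decomp_eigenvalue[OF sd]
  have \<mu>: "\<mu> l \<ge> 0" if "l < d" for l
  proof -
    have "(\<Sum>i<d. \<Sum>j<d. \<rho> $$ (i, j) * u l j * cnj (u l i)) = of_real (\<mu> l)"
      using quad[OF that] by (simp only: mult_ac)
    then show ?thesis
      using psd_quadratic_form[OF assms, of "u l"] by (simp add: less_eq_complex_def)
  qed
  define A where "A = mat d d (\<lambda>(i, l). of_real (sqrt (\<mu> l)) * u l i)"
  have A: "A \<in> carrier_mat d d" by (simp add: A_def)
  have "A * mat_adjoint A = \<rho>"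
  proof (rule eq_matI)
    fix i j assume "i < dim_row \<rho>" "j < dim_col \<rho>"
    then have ij: "i < d" "j < d" using \<rho> by auto
    have "(A * mat_adjoint A) $$ (i, j) = (\<Sum>l<d. A $$ (i, l) * mat_adjoint A $$ (l, j))"
      using A ij by (intro mult_mat_index) auto
    also have "\<dots> = (\<Sum>l<d. of_real (sqrt (\<mu> l) * sqrt (\<mu> l)) * (u l i * cnj (u l j)))"
      using A ij by (intro sum.cong refl) (simp add: mat_adjoint_index A_def del: real_sqrt_mult_self)
    also have "\<dots> = \<rho> $$ (i, j)" unfolding ent[OF ij] real_sqrt_mult_self using \<mu> by (intro sum.cong refl) simp
    finally show "(A * mat_adjoint A) $$ (i, j) = \<rho> $$ (i, j)" .
  qed (use A \<rho> in auto)
  with A show thesis using that by blast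
qed

section \<open>Vectorised Kraus operators\<close>

text \<open>Column stacking in the numbering used by \<open>id_tensor\<close>, so that \<open>(I \<otimes> K) vec M = vec (K M)\<close>.\<close>

definition vec_of :: "nat \<Rightarrow> complex mat \<Rightarrow> nat \<Rightarrow> complex" where
  "vec_of n M i = M $$ (i mod n, i div n)"

text \<open>The squared Hilbert-Schmidt norm, which is the squared length of the vectorised matrix.
  Columns form the outer sum, to match the numbering of \<open>vec_of\<close>.\<close>

definition frob_sq :: "complex mat \<Rightarrow> real" where
  "frob_sq M = (\<Sum>a<dim_col M. \<Sum>p<dim_row M. (cmod (M $$ (p, a)))\<^sup>2)"

lemma mixed_radix_less: "a < k \<Longrightarrow> p < n \<Longrightarrow> a * n + p < k * (n :: nat)"
proof -
  assume "a < k" "p < n"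
  then have "a * n + p < Suc a * n" by simp
  also have "\<dots> \<le> k * n" using \<open>a < k\<close> by (intro mult_le_mono1) simp
  finally show ?thesis .
qed

text \<open>A flat tensor index is i = a * n + p with ancilla index a and system index p, the same
  numbering by which \<open>id_tensor\<close> forms blocks.\<close>

lemma sum_div_mod:
  fixes f :: "nat \<Rightarrow> nat \<Rightarrow> 'a :: comm_monoid_add"
  shows "(\<Sum>i<k * n. f (i mod n) (i div n)) = (\<Sum>a<k. \<Sum>p<n. f p a)"
proof -
  have "(\<Sum>i<k * n. f (i mod n) (i div n)) = (\<Sum>a<k. sum (\<lambda>i. f (i mod n) (i div n)) {a * n..<a * n + n})"
    by (rule sum.nat_group[symmetric])
  also have "\<dots> = (\<Sum>a<k. \<Sum>p<n. f p a)"
  proof (rule sum.cong[OF refl])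
    fix a assume "a \<in> {..<k}"
    have "sum (\<lambda>i. f (i mod n) (i div n)) {a * n..<a * n + n}
        = sum (\<lambda>p. f ((p + a * n) mod n) ((p + a * n) div n)) {0..<n}"
      using sum.shift_bounds_nat_ivl[of "\<lambda>i. f (i mod n) (i div n)" 0 "a * n" n] by (simp add: add.commute)
    then show "sum (\<lambda>i. f (i mod n) (i div n)) {a * n..<a * n + n} = (\<Sum>p<n. f p a)"
      by (simp add: atLeast0LessThan)
  qed
  finally show ?thesis .
qed

lemma sum_vec_of:
  assumes "X \<in> carrier_mat n k"
  shows "(\<Sum>i<k * n. (cmod (vec_of n X i))\<^sup>2) = frob_sq X"
  using sum_div_mod[of "\<lambda>p a. (cmod (X $$ (p, a)))\<^sup>2" n k] assms
  by (simp add: vec_of_def frob_sq_def)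

lemma cip_vec_of:
  assumes "X \<in> carrier_mat n k" "Y \<in> carrier_mat n k"
  shows "cip (k * n) (vec_of n X) (vec_of n Y) = mat_trace (mat_adjoint X * Y)"
proof -
  have "cip (k * n) (vec_of n X) (vec_of n Y) = (\<Sum>a<k. \<Sum>p<n. cnj (X $$ (p, a)) * Y $$ (p, a))"
    unfolding cip_def vec_of_def by (rule sum_div_mod)
  also have "\<dots> = mat_trace (mat_adjoint X * Y)"
    using assms
    by (simp add: mat_trace_def mult_mat_index[OF mat_adjoint_carrier[OF assms(1)] assms(2)]
        mat_adjoint_index del: index_mult_mat(1))
  finally show ?thesis .
qed

lemma frob_sq_trace:
  assumes "X \<in> carrier_mat n k"
  shows "complex_of_real (frob_sq X) = mat_trace (mat_adjoint X * X)"
  using cip_vec_of[OF assms assms] cip_self[of "k * n" "vec_of n X"] sum_vec_of[OF assms] by simp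

lemma mat_trace_adjoint_Cauchy_Schwarz:
  assumes "X \<in> carrier_mat n k" "Y \<in> carrier_mat n k"
  shows "(cmod (mat_trace (mat_adjoint X * Y)))\<^sup>2 \<le> frob_sq X * frob_sq Y"
  using cip_Cauchy_Schwarz[of "k * n" "vec_of n X" "vec_of n Y"]
  by (simp only: cip_vec_of[OF assms] sum_vec_of[OF assms(1)] sum_vec_of[OF assms(2)])

text \<open>The trace-non-increasing condition as a property of a list of operators alone, so that
  it can be used for encoder, channel and decoder alike.\<close>

definition kraus_contraction :: "nat \<Rightarrow> nat \<Rightarrow> complex mat list \<Rightarrow> bool" where
  "kraus_contraction m n Ls \<longleftrightarrow> set Ls \<subseteq> carrier_mat n m \<and>
     psd m (1\<^sub>m m - mat_sum m m (map (\<lambda>L. mat_adjoint L * L) Ls))"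

text \<open>Testing positivity of I - sum L^dag L on the vector \<open>f\<close> says that the
  squared lengths of the vectors L f add up to at most that of f.\<close>

lemma kraus_contraction_vec:
  assumes "kraus_contraction m n Ls"
  shows "(\<Sum>L\<leftarrow>Ls. \<Sum>p<n. (cmod (\<Sum>j<m. L $$ (p, j) * f j))\<^sup>2) \<le> (\<Sum>i<m. (cmod (f i))\<^sup>2)"
proof -
  have LC: "set Ls \<subseteq> carrier_mat n m"
    and P: "psd m (1\<^sub>m m - mat_sum m m (map (\<lambda>L. mat_adjoint L * L) Ls))" (is "psd m (_ - ?S)")
    using assms by (auto simp: kraus_contraction_def)
  have SC: "set (map (\<lambda>L. mat_adjoint L * L) Ls) \<subseteq> carrier_mat m m"
    using LC by (auto intro!: mult_carrier_mat[of _ m n] mat_adjoint_carrier)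
  have S: "?S \<in> carrier_mat m m" by (rule mat_sum_carrier[OF SC])
  have Sij: "?S $$ (i, j) = (\<Sum>L\<leftarrow>Ls. \<Sum>p<n. cnj (L $$ (p, i)) * L $$ (p, j))" if "i < m" "j < m" for i j
  proof -
    have "(mat_adjoint L * L) $$ (i, j) = (\<Sum>p<n. cnj (L $$ (p, i)) * L $$ (p, j))" if "L \<in> set Ls" for L
    proof -
      have L: "L \<in> carrier_mat n m" using LC that by blast
      show ?thesis
        using L \<open>i < m\<close> \<open>j < m\<close>
        by (simp add: mult_mat_index[OF mat_adjoint_carrier[OF L] L] mat_adjoint_index del: index_mult_mat(1))
    qed
    then show ?thesis
      unfolding mat_sum_index[OF SC that] by (simp add: o_def cong: map_cong)
  qed
  have "(\<Sum>i<m. \<Sum>j<m. ?S $$ (i, j) * f j * cnj (f i))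
      = (\<Sum>i<m. \<Sum>j<m. (\<Sum>L\<leftarrow>Ls. \<Sum>p<n. cnj (L $$ (p, i)) * L $$ (p, j)) * f j * cnj (f i))"
    by (intro sum.cong refl) (simp add: Sij)
  also have "\<dots> = complex_of_real (\<Sum>L\<leftarrow>Ls. \<Sum>p<n. (cmod (\<Sum>j<m. L $$ (p, j) * f j))\<^sup>2)"
  proof (induction Ls)
    case Nil
    then show ?case by simp
  next
    case (Cons L Ls)
    have "(\<Sum>i<m. \<Sum>j<m. (\<Sum>p<n. cnj (L $$ (p, i)) * L $$ (p, j)) * f j * cnj (f i))
        = (\<Sum>i<m. \<Sum>j<m. \<Sum>p<n. cnj (L $$ (p, i)) * L $$ (p, j) * f j * cnj (f i))"
      by (simp only: sum_distrib_right)
    also have "\<dots> = (\<Sum>i<m. \<Sum>p<n. \<Sum>j<m. cnj (L $$ (p, i)) * L $$ (p, j) * f j * cnj (f i))"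
      by (intro sum.cong refl sum.swap)
    also have "\<dots> = (\<Sum>p<n. \<Sum>i<m. \<Sum>j<m. cnj (L $$ (p, i)) * L $$ (p, j) * f j * cnj (f i))"
      by (rule sum.swap)
    also have "\<dots> = (\<Sum>p<n. (\<Sum>j<m. L $$ (p, j) * f j) * cnj (\<Sum>i<m. L $$ (p, i) * f i))"
      unfolding cnj_sum sum_product
      by (rule sum.cong[OF refl], subst sum.swap) (simp add: mult_ac)
    finally have "(\<Sum>i<m. \<Sum>j<m. (\<Sum>p<n. cnj (L $$ (p, i)) * L $$ (p, j)) * f j * cnj (f i))
        = complex_of_real (\<Sum>p<n. (cmod (\<Sum>j<m. L $$ (p, j) * f j))\<^sup>2)"
      by (simp only: of_real_sum complex_norm_square)
    then show ?case using Cons by (simp add: distrib_right sum.distrib)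
  qed
  finally have quadS: "(\<Sum>i<m. \<Sum>j<m. ?S $$ (i, j) * f j * cnj (f i))
      = complex_of_real (\<Sum>L\<leftarrow>Ls. \<Sum>p<n. (cmod (\<Sum>j<m. L $$ (p, j) * f j))\<^sup>2)" .
  have quad1: "(\<Sum>i<m. \<Sum>j<m. 1\<^sub>m m $$ (i, j) * f j * cnj (f i)) = complex_of_real (\<Sum>i<m. (cmod (f i))\<^sup>2)"
  proof -
    have "(\<Sum>i<m. \<Sum>j<m. 1\<^sub>m m $$ (i, j) * f j * cnj (f i))
        = (\<Sum>i<m. \<Sum>j<m. if j = i then f i * cnj (f i) else 0)"
      by (intro sum.cong refl) auto
    then show ?thesis by (simp add: complex_norm_square del: of_real_power)
  qed
  have "(\<Sum>i<m. \<Sum>j<m. (1\<^sub>m m - ?S) $$ (i, j) * f j * cnj (f i))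
      = (\<Sum>i<m. \<Sum>j<m. 1\<^sub>m m $$ (i, j) * f j * cnj (f i)) - (\<Sum>i<m. \<Sum>j<m. ?S $$ (i, j) * f j * cnj (f i))"
    unfolding sum_subtractf[symmetric] using S
    by (intro sum.cong refl) (simp add: algebra_simps)
  then show ?thesis
    using psd_quadratic_form[OF P, of f] unfolding quadS quad1
    by (simp add: less_eq_complex_def)
qed

lemma sum_list_sum_swap: "(\<Sum>x\<leftarrow>xs. \<Sum>a\<in>A. f x a) = (\<Sum>a\<in>A. \<Sum>x\<leftarrow>xs. (f x a :: 'b :: comm_monoid_add))"
  by (induction xs) (auto simp: sum.distrib)

text \<open>The contraction of vectors, applied to each column of V separately.\<close>

lemma kraus_contraction_frob:
  assumes "kraus_contraction m n Ls" "V \<in> carrier_mat m k"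
  shows "(\<Sum>L\<leftarrow>Ls. frob_sq (L * V)) \<le> frob_sq V"
proof -
  have "frob_sq (L * V) = (\<Sum>a<k. \<Sum>p<n. (cmod (\<Sum>j<m. L $$ (p, j) * V $$ (j, a)))\<^sup>2)" if "L \<in> set Ls" for L
  proof -
    have L: "L \<in> carrier_mat n m" using assms(1) that by (auto simp: kraus_contraction_def)
    show ?thesis
      using L assms(2) by (simp add: frob_sq_def mult_mat_index[OF L assms(2)] del: index_mult_mat(1))
  qed
  then have "(\<Sum>L\<leftarrow>Ls. frob_sq (L * V))
      = (\<Sum>L\<leftarrow>Ls. \<Sum>a<k. \<Sum>p<n. (cmod (\<Sum>j<m. L $$ (p, j) * V $$ (j, a)))\<^sup>2)"
    by (simp cong: map_cong)
  also have "\<dots> = (\<Sum>a<k. \<Sum>L\<leftarrow>Ls. \<Sum>p<n. (cmod (\<Sum>j<m. L $$ (p, j) * V $$ (j, a)))\<^sup>2)"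
    by (rule sum_list_sum_swap)
  also have "\<dots> \<le> (\<Sum>a<k. \<Sum>i<m. (cmod (V $$ (i, a)))\<^sup>2)"
    by (intro sum_mono kraus_contraction_vec[OF assms(1)])
  also have "\<dots> = frob_sq V" using assms(2) by (simp add: frob_sq_def)
  finally show ?thesis .
qed

section \<open>Composition of Kraus families and their action on vectorised operators\<close>

definition mat_products :: "complex mat list \<Rightarrow> complex mat list \<Rightarrow> complex mat list" where
  "mat_products Ks Bs = concat (map (\<lambda>K. map (\<lambda>B. K * B) Bs) Ks)"

lemma sum_list_mat_products: "(\<Sum>X\<leftarrow>mat_products Ks Bs. f X) = (\<Sum>K\<leftarrow>Ks. \<Sum>B\<leftarrow>Bs. f (K * B))"
  unfolding mat_products_def by (induction Ks) (auto simp: o_def)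

lemma mat_products_carrier:
  assumes "set Ks \<subseteq> carrier_mat n m" "set Bs \<subseteq> carrier_mat m k"
  shows "set (mat_products Ks Bs) \<subseteq> carrier_mat n k"
  using assms by (fastforce simp: mat_products_def)

lemma conj_mat_sum:
  assumes "L \<in> carrier_mat p n" "set Xs \<subseteq> carrier_mat n n"
  shows "L * mat_sum n n Xs * mat_adjoint L = mat_sum p p (map (\<lambda>X. L * X * mat_adjoint L) Xs)"
  using assms(2)
proof (induction Xs)
  case Nil
  then show ?case using assms(1) by (simp add: mat_sum_def)
next
  case (Cons X Xs)
  have X: "X \<in> carrier_mat n n" and M: "mat_sum n n Xs \<in> carrier_mat n n"
    using Cons.prems mat_sum_carrier[of Xs n n] by auto
  have "L * (X + mat_sum n n Xs) * mat_adjoint L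
      = L * X * mat_adjoint L + L * mat_sum n n Xs * mat_adjoint L"
    using mult_add_distrib_mat[OF assms(1) X M]
      add_mult_distrib_mat[OF mult_carrier_mat[OF assms(1) X] mult_carrier_mat[OF assms(1) M] mat_adjoint_carrier[OF assms(1)]]
    by simp
  then show ?case using Cons by (simp add: mat_sum_def)
qed

lemma mat_sum_append:
  assumes "set Xs \<subseteq> carrier_mat n m" "set Ys \<subseteq> carrier_mat n m"
  shows "mat_sum n m (Xs @ Ys) = mat_sum n m Xs + mat_sum n m Ys"
  using assms(1)
proof (induction Xs)
  case Nil
  then show ?case using mat_sum_carrier[OF assms(2)] by (simp add: mat_sum_def)
next
  case (Cons X Xs)
  then have "X \<in> carrier_mat n m" "mat_sum n m Xs \<in> carrier_mat n m" "mat_sum n m Ys \<in> carrier_mat n m"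
    using mat_sum_carrier[OF assms(2)] mat_sum_carrier[of Xs n m] by auto
  then show ?case using Cons by (simp add: mat_sum_def assoc_add_mat[of _ n m])
qed

lemma conj_carrier:
  assumes "L \<in> carrier_mat p n" "X \<in> carrier_mat n n"
  shows "L * X * mat_adjoint L \<in> carrier_mat p p"
  using assms by (intro mult_carrier_mat[of _ p n] mat_adjoint_carrier) auto

lemma kraus_operators_comp:
  assumes "kraus_operators m n Ks \<Phi>" "kraus_operators n p Ls \<Psi>"
  shows "kraus_operators m p (mat_products Ls Ks) (\<Psi> \<circ> \<Phi>)"
  unfolding kraus_operators_def
proof (intro conjI ballI)
  have KC: "set Ks \<subseteq> carrier_mat n m" and LC: "set Ls \<subseteq> carrier_mat p n"
    using assms by (auto simp: kraus_operators_def)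
  show "set (mat_products Ls Ks) \<subseteq> carrier_mat p m" by (rule mat_products_carrier[OF LC KC])
  fix X :: "complex mat" assume X: "X \<in> carrier_mat m m"
  let ?Y = "map (\<lambda>K. K * X * mat_adjoint K) Ks"
  have YC: "set ?Y \<subseteq> carrier_mat n n" using KC conj_carrier[OF _ X] by auto
  have \<Phi>X: "\<Phi> X = mat_sum n n ?Y" using assms(1) X by (simp add: kraus_operators_def)
  have "(\<Psi> \<circ> \<Phi>) X = mat_sum p p (map (\<lambda>L. L * mat_sum n n ?Y * mat_adjoint L) Ls)"
    using assms(2) mat_sum_carrier[OF YC] by (simp add: kraus_operators_def \<Phi>X)
  also have "\<dots> = mat_sum p p (map (\<lambda>F. F * X * mat_adjoint F) (mat_products Ls Ks))"
    using LC
  proof (induction Ls)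
    case Nil
    then show ?case by (simp add: mat_products_def)
  next
    case (Cons L Ls)
    have L: "L \<in> carrier_mat p n" and LsC: "set Ls \<subseteq> carrier_mat p n" using Cons.prems by auto
    have one: "L * (K * X * mat_adjoint K) * mat_adjoint L = (L * K) * X * mat_adjoint (L * K)"
      if "K \<in> set Ks" for K
    proof -
      have K: "K \<in> carrier_mat n m" using KC that by blast
      have Ka: "mat_adjoint K \<in> carrier_mat m n" and La: "mat_adjoint L \<in> carrier_mat n p"
        using K L by simp_all
      have KX: "K * X \<in> carrier_mat n m" using K X by (rule mult_carrier_mat)
      show ?thesis
        unfolding mat_adjoint_mult[OF L K] assoc_mult_mat[OF L K X]
          assoc_mult_mat[OF L KX Ka, symmetric]
        by (rule assoc_mult_mat[OF mult_carrier_mat[OF L KX] Ka La])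
    qed
    have C1: "set (map (\<lambda>F. F * X * mat_adjoint F) (map (\<lambda>K. L * K) Ks)) \<subseteq> carrier_mat p p"
      using KC L conj_carrier[OF _ X] by auto
    have C2: "set (map (\<lambda>F. F * X * mat_adjoint F) (mat_products Ls Ks)) \<subseteq> carrier_mat p p"
      using mat_products_carrier[OF LsC KC] conj_carrier[OF _ X] by auto
    have eq: "map (\<lambda>Z. L * Z * mat_adjoint L) ?Y = map (\<lambda>F. F * X * mat_adjoint F) (map (\<lambda>K. L * K) Ks)"
      using one by auto
    have "L * mat_sum n n ?Y * mat_adjoint L
        = mat_sum p p (map (\<lambda>F. F * X * mat_adjoint F) (map (\<lambda>K. L * K) Ks))"
      using conj_mat_sum[OF L YC] unfolding eq .
    moreover have "mat_products (L # Ls) Ks = map (\<lambda>K. L * K) Ks @ mat_products Ls Ks"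
      by (simp add: mat_products_def)
    ultimately show ?case
      using Cons.IH[OF LsC] mat_sum_append[OF C1 C2] by (simp add: mat_sum_def)
  qed
  finally show "(\<Psi> \<circ> \<Phi>) X = mat_sum p p (map (\<lambda>F. F * X * mat_adjoint F) (mat_products Ls Ks))" .
qed

text \<open>The conjugated matrix is a sum of outer products of column a with column b of each B.
  Conjugation by K moves K onto both columns, which become columns of K B.\<close>

lemma conj_sum_outer:
  assumes K: "K \<in> carrier_mat n m" and "set Bs \<subseteq> carrier_mat m k"
    and "p < n" "q < n" "a < k" "b < k"
  shows "(K * mat m m (\<lambda>(r, s). \<Sum>B\<leftarrow>Bs. B $$ (r, a) * cnj (B $$ (s, b))) * mat_adjoint K) $$ (p, q)
    = (\<Sum>B\<leftarrow>Bs. (K * B) $$ (p, a) * cnj ((K * B) $$ (q, b)))"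
proof -
  let ?X = "\<lambda>Bs. mat m m (\<lambda>(r, s). \<Sum>B\<leftarrow>Bs. B $$ (r, a) * cnj (B $$ (s, b)))"
  have X: "?X Bs \<in> carrier_mat m m" for Bs by simp
  have "(K * ?X Bs * mat_adjoint K) $$ (p, q) = (\<Sum>s<m. (K * ?X Bs) $$ (p, s) * mat_adjoint K $$ (s, q))"
    using assms by (intro mult_mat_index[OF mult_carrier_mat[OF K X]]) auto
  also have "\<dots> = (\<Sum>s<m. (\<Sum>r<m. K $$ (p, r) * (\<Sum>B\<leftarrow>Bs. B $$ (r, a) * cnj (B $$ (s, b)))) * cnj (K $$ (q, s)))"
    using assms by (intro sum.cong refl) (simp add: mult_mat_index[OF K X] mat_adjoint_index del: index_mult_mat(1))
  also have "\<dots> = (\<Sum>B\<leftarrow>Bs. (\<Sum>r<m. K $$ (p, r) * B $$ (r, a)) * cnj (\<Sum>s<m. K $$ (q, s) * B $$ (s, b)))"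
  proof (induction Bs)
    case Nil
    then show ?case by simp
  next
    case (Cons B Bs)
    have "(\<Sum>s<m. (\<Sum>r<m. K $$ (p, r) * (B $$ (r, a) * cnj (B $$ (s, b)))) * cnj (K $$ (q, s)))
        = (\<Sum>r<m. K $$ (p, r) * B $$ (r, a)) * cnj (\<Sum>s<m. K $$ (q, s) * B $$ (s, b))"
      by (simp add: sum_distrib_left sum_distrib_right mult_ac)
    then show ?case using Cons by (simp add: distrib_left distrib_right sum.distrib)
  qed
  also have "\<dots> = (\<Sum>B\<leftarrow>Bs. (K * B) $$ (p, a) * cnj ((K * B) $$ (q, b)))"
  proof -
    have "(\<Sum>r<m. K $$ (p, r) * B $$ (r, a)) = (K * B) $$ (p, a)"
         "(\<Sum>s<m. K $$ (q, s) * B $$ (s, b)) = (K * B) $$ (q, b)" if "B \<in> set Bs" for B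
      using assms that by (auto intro!: mult_mat_index[symmetric])
    then show ?thesis by (simp cong: map_cong)
  qed
  finally show ?thesis .
qed

text \<open>This is (I \<otimes> K) vec B = vec (K B) for each pair of K and B: the factored form
  survives the channel, with the list of matrices multiplied by the Kraus list.\<close>

lemma id_tensor_gram:
  assumes "kraus_operators m n Ks \<Phi>" and BC: "set Bs \<subseteq> carrier_mat m k"
  shows "id_tensor k m n \<Phi> (gram (k * m) (map (vec_of m) Bs)) = gram (k * n) (map (vec_of n) (mat_products Ks Bs))"
    (is "?L = ?R")
proof (rule eq_matI)
  have KC: "set Ks \<subseteq> carrier_mat n m" using assms(1) by (simp add: kraus_operators_def)
  fix i j assume "i < dim_row ?R" "j < dim_col ?R"
  then have ij: "i < k * n" "j < k * n" by auto
  then have n: "n > 0" by (cases n) auto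
  have lt: "i mod n < n" "j mod n < n" "i div n < k" "j div n < k"
    using ij n by (auto simp: less_mult_imp_div_less)
  let ?X = "mat m m (\<lambda>(r, s). \<Sum>B\<leftarrow>Bs. B $$ (r, i div n) * cnj (B $$ (s, j div n)))"
  \<comment> \<open>Block (a, b) of the Gram matrix collects the outer products of columns a and b
    of the matrices in \<open>Bs\<close>.\<close>
  have bl: "mat_block m (gram (k * m) (map (vec_of m) Bs)) (i div n) (j div n) = ?X"
    using lt mixed_radix_less[of "i div n" k _ m] mixed_radix_less[of "j div n" k _ m]
    by (intro eq_matI) (auto simp: mat_block_def gram_def vec_of_def o_def)
  have C: "set (map (\<lambda>K. K * ?X * mat_adjoint K) Ks) \<subseteq> carrier_mat n n"
    using KC by (auto intro!: conj_carrier)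
  have "?L $$ (i, j) = \<Phi> ?X $$ (i mod n, j mod n)"
    using ij by (simp add: id_tensor_def bl)
  also have "\<Phi> ?X = mat_sum n n (map (\<lambda>K. K * ?X * mat_adjoint K) Ks)"
    using assms(1) by (simp add: kraus_operators_def)
  also have "\<dots> $$ (i mod n, j mod n) = (\<Sum>K\<leftarrow>Ks. (K * ?X * mat_adjoint K) $$ (i mod n, j mod n))"
    unfolding mat_sum_index[OF C lt(1,2)] map_map o_def ..
  also have "\<dots> = (\<Sum>K\<leftarrow>Ks. \<Sum>B\<leftarrow>Bs. (K * B) $$ (i mod n, i div n) * cnj ((K * B) $$ (j mod n, j div n)))"
    using KC by (intro arg_cong[where f = sum_list] map_cong refl conj_sum_outer[OF _ BC lt]) auto
  also have "\<dots> = ?R $$ (i, j)"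
    using ij by (simp add: gram_def vec_of_def o_def sum_list_mat_products)
  finally show "?L $$ (i, j) = ?R $$ (i, j)" .
qed (auto simp: id_tensor_def)

lemma id_tensor_minus:
  assumes "\<And>X. X \<in> carrier_mat m m \<Longrightarrow> \<Phi> X \<in> carrier_mat n n"
    "\<And>X. X \<in> carrier_mat m m \<Longrightarrow> \<Psi> X \<in> carrier_mat n n"
  shows "id_tensor k m n (\<lambda>X. \<Phi> X - \<Psi> X) W = id_tensor k m n \<Phi> W - id_tensor k m n \<Psi> W"
proof (rule eq_matI)
  fix i j assume "i < dim_row (id_tensor k m n \<Phi> W - id_tensor k m n \<Psi> W)"
    "j < dim_col (id_tensor k m n \<Phi> W - id_tensor k m n \<Psi> W)"
  then have ij: "i < k * n" "j < k * n" by (auto simp: id_tensor_def)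
  then have "n > 0" by (cases n) auto
  let ?X = "mat_block m W (i div n) (j div n)"
  have X: "?X \<in> carrier_mat m m" by (simp add: mat_block_def)
  from assms(1,2)[OF X] show "id_tensor k m n (\<lambda>X. \<Phi> X - \<Psi> X) W $$ (i, j)
      = (id_tensor k m n \<Phi> W - id_tensor k m n \<Psi> W) $$ (i, j)"
    using ij \<open>n > 0\<close> by (simp add: id_tensor_def)
qed (auto simp: id_tensor_def)

text \<open>The right-hand side does not mention \<Phi>, so two trace-preserving maps give the same
  trace on the same input. This makes the trace of \<open>Y\<close> vanish later.\<close>

lemma cptp_trace_id_tensor:
  assumes "cptp m n \<Phi>"
  shows "mat_trace (id_tensor k m n \<Phi> W) = (\<Sum>a<k. mat_trace (mat_block m W a a))"
proof -
  have \<Phi>: "\<Phi> X \<in> carrier_mat n n" "mat_trace (\<Phi> X) = mat_trace X" if "X \<in> carrier_mat m m" for X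
    using assms that by (auto simp: cptp_def completely_positive_def linear_mat_map_def)
  have "mat_trace (id_tensor k m n \<Phi> W)
      = (\<Sum>i<k * n. \<Phi> (mat_block m W (i div n) (i div n)) $$ (i mod n, i mod n))"
    by (simp add: mat_trace_def id_tensor_def)
  also have "\<dots> = (\<Sum>a<k. \<Sum>p<n. \<Phi> (mat_block m W a a) $$ (p, p))"
    by (rule sum_div_mod)
  also have "\<dots> = (\<Sum>a<k. mat_trace (mat_block m W a a))"
  proof (intro sum.cong refl)
    fix a assume "a \<in> {..<k}"
    have X: "mat_block m W a a \<in> carrier_mat m m" by (simp add: mat_block_def)
    show "(\<Sum>p<n. \<Phi> (mat_block m W a a) $$ (p, p)) = mat_trace (mat_block m W a a)"
      using \<Phi>[OF X] by (simp add: mat_trace_def)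
  qed
  finally show ?thesis .
qed

section \<open>Stability of the fidelity\<close>

lemma sum_list_swap:
  "(\<Sum>x\<leftarrow>xs. \<Sum>y\<leftarrow>ys. f x y) = (\<Sum>y\<leftarrow>ys. \<Sum>x\<leftarrow>xs. (f x y :: 'a :: comm_monoid_add))"
  by (induction xs) (auto simp: sum_list_addf)

lemma cptniE:
  assumes "cptni m n \<Phi>"
  obtains Ks where "kraus_operators m n Ks \<Phi>" "kraus_contraction m n Ks"
  using assms unfolding cptni_def kraus_contraction_def kraus_operators_def by blast

lemma cptni_carrier: "cptni m n \<Phi> \<Longrightarrow> X \<in> carrier_mat m m \<Longrightarrow> \<Phi> X \<in> carrier_mat n n"
  by (auto simp: cptni_def completely_positive_def linear_mat_map_def)

text \<open>Zero maps show that the index sets of both suprema are nonempty, and they serve as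
  sample encoder and decoder when the diamond norm is shown to be nonnegative.\<close>

lemma cptni_zero: "cptni m n (\<lambda>X. 0\<^sub>m n n)"
proof -
  have "psd k (0\<^sub>m k k)" for k
    unfolding psd_def
  proof (intro conjI ballI)
    fix v :: "complex vec" assume v: "v \<in> carrier_vec k"
    have "0\<^sub>m k k *\<^sub>v v = 0\<^sub>v k" using v by (intro eq_vecI) auto
    then show "0 \<le> (0\<^sub>m k k *\<^sub>v v) \<bullet>c v" using v by simp
  qed simp
  moreover have "id_tensor k m n (\<lambda>X. 0\<^sub>m n n) X = 0\<^sub>m (k * n) (k * n)" for k X
  proof (rule eq_matI)
    fix i j assume "i < dim_row (0\<^sub>m (k * n) (k * n) :: complex mat)" "j < dim_col (0\<^sub>m (k * n) (k * n) :: complex mat)"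
    then have ij: "i < k * n" "j < k * n" by auto
    then have "n > 0" by (cases n) auto
    then show "id_tensor k m n (\<lambda>X. 0\<^sub>m n n) X $$ (i, j) = 0\<^sub>m (k * n) (k * n) $$ (i, j)"
      using ij by (simp add: id_tensor_def)
  qed (auto simp: id_tensor_def)
  moreover have "kraus_operators m n [] (\<lambda>X. 0\<^sub>m n n)"
    by (simp add: kraus_operators_def mat_sum_def)
  moreover have "psd m (1\<^sub>m m - mat_sum m m (map (\<lambda>L. mat_adjoint L * L) []))"
  proof -
    have "1\<^sub>m m - mat_sum m m (map (\<lambda>L. mat_adjoint L * L) []) = (1\<^sub>m m :: complex mat)"
      by (intro eq_matI) (auto simp: mat_sum_def)
    moreover have "psd m (1\<^sub>m m)" by (auto simp: psd_def)
    ultimately show ?thesis by simp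
  qed
  ultimately show ?thesis
    by (auto simp: cptni_def completely_positive_def linear_mat_map_def intro!: exI[of _ "[]"])
qed

lemma choi_rank_zero: "choi_rank m n (\<lambda>X. 0\<^sub>m n n) = 0"
  unfolding choi_rank_def by (rule Least_eq_0) (simp add: kraus_operators_def mat_sum_def)

text \<open>Cyclicity gives tr(A^dag A) = tr(A A^dag) = tr \<rho> = 1, so vec A is a unit
  vector.\<close>

lemma density_operator_purification:
  assumes "density_operator d \<rho>"
  obtains A where "A \<in> carrier_mat d d" "A * mat_adjoint A = \<rho>" "frob_sq A = 1"
proof -
  obtain A where A: "A \<in> carrier_mat d d" "A * mat_adjoint A = \<rho>"
    using psd_square_root assms unfolding density_operator_def by metis
  have "complex_of_real (frob_sq A) = mat_trace (A * mat_adjoint A)"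
    unfolding frob_sq_trace[OF A(1)] using A(1) by (intro mat_trace_comm[of _ d d]) auto
  then have "frob_sq A = 1" using assms A(2) by (simp add: density_operator_def)
  with A show thesis using that by blast
qed

text \<open>If v = vec V, the inner product of vec(D^dag A) with v is tr(A^dag D V). Cauchy-Schwarz
  bounds its square by the squared Hilbert-Schmidt norm of D V, and the decoder condition bounds the
  sum over D by that of V.\<close>

lemma decoder_vectors_contraction:
  assumes D: "kraus_contraction c d Ds" and A: "A \<in> carrier_mat d k" "frob_sq A \<le> 1"
  shows "(\<Sum>e\<leftarrow>map (\<lambda>D. vec_of c (mat_adjoint D * A)) Ds. (cmod (cip (k * c) e v))\<^sup>2)
    \<le> (\<Sum>i<k * c. (cmod (v i))\<^sup>2)"
proof -
  \<comment> \<open>Undoes the vectorisation: column a of V is block a of v.\<close>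
  define V where "V = mat c k (\<lambda>(p, a). v (a * c + p))"
  have V: "V \<in> carrier_mat c k" by (simp add: V_def)
  have v: "v i = vec_of c V i" if "i < k * c" for i
  proof -
    have "c > 0" using that by (cases c) auto
    then show ?thesis using that by (simp add: V_def vec_of_def less_mult_imp_div_less)
  qed
  have le: "(cmod (cip (k * c) (vec_of c (mat_adjoint D * A)) v))\<^sup>2 \<le> frob_sq (D * V)" if "D \<in> set Ds" for D
  proof -
    have DC: "D \<in> carrier_mat d c" using D that by (auto simp: kraus_contraction_def)
    have DA: "mat_adjoint D * A \<in> carrier_mat c k" using DC A(1) by (intro mult_carrier_mat mat_adjoint_carrier)
    have DV: "D * V \<in> carrier_mat d k" using DC V by (rule mult_carrier_mat)
    have "cip (k * c) (vec_of c (mat_adjoint D * A)) v = cip (k * c) (vec_of c (mat_adjoint D * A)) (vec_of c V)"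
      unfolding cip_def by (intro sum.cong refl) (simp add: v)
    also have "\<dots> = mat_trace (mat_adjoint (mat_adjoint D * A) * V)" by (rule cip_vec_of[OF DA V])
    also have "mat_adjoint (mat_adjoint D * A) * V = mat_adjoint A * (D * V)"
      using mat_adjoint_mult[OF mat_adjoint_carrier[OF DC] A(1)] assoc_mult_mat[OF mat_adjoint_carrier[OF A(1)] DC V]
      by simp
    finally have "(cmod (cip (k * c) (vec_of c (mat_adjoint D * A)) v))\<^sup>2 \<le> frob_sq A * frob_sq (D * V)"
      using mat_trace_adjoint_Cauchy_Schwarz[OF A(1) DV] by simp
    also have "\<dots> \<le> frob_sq (D * V)"
      using mult_right_mono[OF A(2), of "frob_sq (D * V)"] by (simp add: frob_sq_def sum_nonneg)
    finally show ?thesis .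
  qed
  have "(\<Sum>D\<leftarrow>Ds. (cmod (cip (k * c) (vec_of c (mat_adjoint D * A)) v))\<^sup>2) \<le> (\<Sum>D\<leftarrow>Ds. frob_sq (D * V))"
    by (rule sum_list_mono) (rule le)
  also have "\<dots> \<le> frob_sq V" by (rule kraus_contraction_frob[OF D V])
  also have "\<dots> = (\<Sum>i<k * c. (cmod (v i))\<^sup>2)"
    unfolding sum_vec_of[OF V, symmetric] by (intro sum.cong refl) (simp add: v)
  finally show ?thesis by (simp add: o_def)
qed

text \<open>Moving A cyclically to the end gives tr(\<rho> D N C) = tr((D^dag A)^dag N C A), a
  Hilbert-Schmidt inner product that separates the decoder from channel and encoder.\<close>

lemma entanglement_fidelity_purification:
  assumes A: "A \<in> carrier_mat d d" and \<rho>: "A * mat_adjoint A = \<rho>"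
    and C: "kraus_operators d c Cs \<C>" and N: "kraus_operators c c Ns \<N>" and D: "kraus_operators c d Ds \<D>"
  shows "entanglement_fidelity d \<rho> (\<D> \<circ> \<N> \<circ> \<C>) =
    (\<Sum>e\<leftarrow>map (\<lambda>D. vec_of c (mat_adjoint D * A)) Ds.
      \<Sum>g\<leftarrow>map (vec_of c) (mat_products Ns (map (\<lambda>C. C * A) Cs)). (cmod (cip (d * c) e g))\<^sup>2)"
proof -
  have \<rho>C: "\<rho> \<in> carrier_mat d d" unfolding \<rho>[symmetric] using A by (intro mult_carrier_mat mat_adjoint_carrier)
  have kr: "kraus_operators d d (mat_products Ds (mat_products Ns Cs)) (\<D> \<circ> \<N> \<circ> \<C>)"
    using kraus_operators_comp[OF kraus_operators_comp[OF C N] D] by (simp add: comp_assoc)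
  have tr: "mat_trace (\<rho> * (D * (N * C))) = cip (d * c) (vec_of c (mat_adjoint D * A)) (vec_of c (N * (C * A)))"
    if "D \<in> set Ds" "N \<in> set Ns" "C \<in> set Cs" for D N C
  proof -
    have cD: "D \<in> carrier_mat d c" and cN: "N \<in> carrier_mat c c" and cC: "C \<in> carrier_mat c d"
      using that C N D by (auto simp: kraus_operators_def)
    have cA: "mat_adjoint A \<in> carrier_mat d d" using A by simp
    have NC: "N * C \<in> carrier_mat c d" using cN cC by (rule mult_carrier_mat)
    have DNC: "D * (N * C) \<in> carrier_mat d d" using cD NC by (rule mult_carrier_mat)
    have "mat_trace (\<rho> * (D * (N * C))) = mat_trace (A * (mat_adjoint A * (D * (N * C))))"
      unfolding \<rho>[symmetric] assoc_mult_mat[OF A cA DNC] ..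
    also have "\<dots> = mat_trace (mat_adjoint A * (D * (N * C)) * A)"
      by (rule mat_trace_comm[OF A mult_carrier_mat[OF cA DNC]])
    also have "mat_adjoint A * (D * (N * C)) * A = mat_adjoint A * D * (N * (C * A))"
      unfolding assoc_mult_mat[OF cA cD NC, symmetric] assoc_mult_mat[OF mult_carrier_mat[OF cA cD] NC A]
        assoc_mult_mat[OF cN cC A] ..
    also have "mat_adjoint A * D = mat_adjoint (mat_adjoint D * A)"
      using mat_adjoint_mult[OF mat_adjoint_carrier[OF cD] A] by simp
    also have "mat_trace (mat_adjoint (mat_adjoint D * A) * (N * (C * A)))
        = cip (d * c) (vec_of c (mat_adjoint D * A)) (vec_of c (N * (C * A)))"
      using cD cN cC A by (intro cip_vec_of[symmetric] mult_carrier_mat[of _ c d] mult_carrier_mat[of _ c c] mat_adjoint_carrier) auto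
    finally show ?thesis .
  qed
  have "entanglement_fidelity d \<rho> (\<D> \<circ> \<N> \<circ> \<C>)
      = (\<Sum>D\<leftarrow>Ds. \<Sum>N\<leftarrow>Ns. \<Sum>C\<leftarrow>Cs. (cmod (mat_trace (\<rho> * (D * (N * C)))))\<^sup>2)"
    unfolding entanglement_fidelity_eq[OF \<rho>C kr] kraus_fidelity_def sum_list_mat_products ..
  also have "\<dots> = (\<Sum>D\<leftarrow>Ds. \<Sum>N\<leftarrow>Ns. \<Sum>C\<leftarrow>Cs.
      (cmod (cip (d * c) (vec_of c (mat_adjoint D * A)) (vec_of c (N * (C * A)))))\<^sup>2)"
    by (simp add: tr cong: map_cong)
  finally show ?thesis by (simp add: o_def sum_list_mat_products)
qed

text \<open>All three bounds use the same purification and Kraus lists. Encoder and decoder are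
  common to both channels, so \<open>\<omega>\<close> and \<open>es\<close> are too, and the
  difference of fidelities is linear in \<open>Y\<close>.\<close>

lemma fidelity_difference:
  assumes \<rho>: "density_operator d \<rho>" and d: "1 \<le> d" and C: "cptni d c \<C>" and D: "cptni c d \<D>"
    and N: "cptni c c \<N>" and N': "cptni c c \<N>'"
  shows "entanglement_fidelity d \<rho> (\<D> \<circ> \<N> \<circ> \<C>) \<le> 1"
    and "ereal \<bar>entanglement_fidelity d \<rho> (\<D> \<circ> \<N> \<circ> \<C>) - entanglement_fidelity d \<rho> (\<D> \<circ> \<N>' \<circ> \<C>)\<bar>
      \<le> diamond_norm c c (\<lambda>X. \<N> X - \<N>' X)"
    and "cptp c c \<N> \<Longrightarrow> cptp c c \<N>' \<Longrightarrow>
      ereal (2 * \<bar>entanglement_fidelity d \<rho> (\<D> \<circ> \<N> \<circ> \<C>) - entanglement_fidelity d \<rho> (\<D> \<circ> \<N>' \<circ> \<C>)\<bar>)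
      \<le> diamond_norm c c (\<lambda>X. \<N> X - \<N>' X)"
proof -
  obtain A where A: "A \<in> carrier_mat d d" "A * mat_adjoint A = \<rho>" "frob_sq A = 1"
    using density_operator_purification[OF \<rho>] by blast
  obtain Cs where kC: "kraus_operators d c Cs \<C>" and cC: "kraus_contraction d c Cs" using cptniE[OF C] .
  obtain Ds where kD: "kraus_operators c d Ds \<D>" and cD: "kraus_contraction c d Ds" using cptniE[OF D] .
  obtain Ns where kN: "kraus_operators c c Ns \<N>" and cN: "kraus_contraction c c Ns" using cptniE[OF N] .
  obtain Ns' where kN': "kraus_operators c c Ns' \<N>'" using cptniE[OF N'] .
  define es where "es = map (\<lambda>D. vec_of c (mat_adjoint D * A)) Ds"
  define Bs where "Bs = map (\<lambda>C. C * A) Cs"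
  define G where "G Ns = gram (d * c) (map (vec_of c) (mat_products Ns Bs))" for Ns
  define \<omega> where "\<omega> = gram (d * c) (map (vec_of c) Bs)"
  have BC: "set Bs \<subseteq> carrier_mat c d"
    using kC A(1) by (auto simp: Bs_def kraus_operators_def intro!: mult_carrier_mat[of _ c d])
  have contr: "(\<Sum>e\<leftarrow>es. (cmod (cip (d * c) e v))\<^sup>2) \<le> (\<Sum>i<d * c. (cmod (v i))\<^sup>2)" for v
    unfolding es_def using decoder_vectors_contraction[OF cD A(1)] A(3) by simp
  have B1: "(\<Sum>B\<leftarrow>Bs. frob_sq B) \<le> 1"
    using kraus_contraction_frob[OF cC A(1)] A(3) by (simp add: Bs_def o_def)
  have fid: "complex_of_real (entanglement_fidelity d \<rho> (\<D> \<circ> \<M> \<circ> \<C>)) = quad_sum (d * c) es (G Ms)"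
    if "kraus_operators c c Ms \<M>" for \<M> Ms
    unfolding entanglement_fidelity_purification[OF A(1,2) kC that kD] G_def quad_sum_gram es_def Bs_def ..
  \<comment> \<open>The bound by 1 chains three contractions: the decoder vectors, then
    \<open>Ns\<close> on each B, then \<open>Cs\<close> on A, whose squared norm is 1.\<close>
  have "entanglement_fidelity d \<rho> (\<D> \<circ> \<N> \<circ> \<C>)
      = (\<Sum>e\<leftarrow>es. \<Sum>g\<leftarrow>map (vec_of c) (mat_products Ns Bs). (cmod (cip (d * c) e g))\<^sup>2)"
    unfolding entanglement_fidelity_purification[OF A(1,2) kC kN kD] es_def Bs_def ..
  also have "\<dots> = (\<Sum>g\<leftarrow>map (vec_of c) (mat_products Ns Bs). \<Sum>e\<leftarrow>es. (cmod (cip (d * c) e g))\<^sup>2)"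
    by (rule sum_list_swap)
  also have "\<dots> \<le> (\<Sum>g\<leftarrow>map (vec_of c) (mat_products Ns Bs). \<Sum>i<d * c. (cmod (g i))\<^sup>2)"
    by (intro sum_list_mono contr)
  also have "\<dots> = (\<Sum>X\<leftarrow>mat_products Ns Bs. frob_sq X)"
  proof -
    have "set (mat_products Ns Bs) \<subseteq> carrier_mat c d"
      using mat_products_carrier[OF _ BC] cN by (auto simp: kraus_contraction_def)
    then show ?thesis unfolding map_map o_def
      by (intro arg_cong[where f = sum_list] map_cong refl sum_vec_of) blast
  qed
  \<comment> \<open>With the sum over \<open>Ns\<close> innermost, the contraction applies for each
    fixed B.\<close>
  also have "\<dots> = (\<Sum>B\<leftarrow>Bs. \<Sum>N\<leftarrow>Ns. frob_sq (N * B))"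
    unfolding sum_list_mat_products by (rule sum_list_swap)
  also have "\<dots> \<le> (\<Sum>B\<leftarrow>Bs. frob_sq B)"
    using BC by (intro sum_list_mono kraus_contraction_frob[OF cN]) auto
  also have "\<dots> \<le> 1" by (rule B1)
  finally show "entanglement_fidelity d \<rho> (\<D> \<circ> \<N> \<circ> \<C>) \<le> 1" .

  define Y where "Y = G Ns - G Ns'"
  have GC: "G Ms \<in> carrier_mat (d * c) (d * c)" for Ms by (simp add: G_def)
  have YC: "Y \<in> carrier_mat (d * c) (d * c)" unfolding Y_def using GC by (rule minus_carrier_mat)
  have Yh: "mat_adjoint Y = Y"
  proof (rule eq_matI)
    fix i j assume "i < dim_row Y" "j < dim_col Y"
    then have ij: "i < d * c" "j < d * c" using YC by auto
    have *: "cnj (G Ms $$ (j, i)) = G Ms $$ (i, j)" for Ms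
    proof -
      have "mat_adjoint (G Ms) $$ (i, j) = cnj (G Ms $$ (j, i))"
        using GC[of Ms] ij by (intro mat_adjoint_index) auto
      then show ?thesis by (simp add: G_def gram_hermitian)
    qed
    have "mat_adjoint Y $$ (i, j) = cnj (Y $$ (j, i))"
      using YC ij by (intro mat_adjoint_index) auto
    also have "\<dots> = Y $$ (i, j)"
      using ij GC[of Ns] GC[of Ns'] * by (simp add: Y_def)
    finally show "mat_adjoint Y $$ (i, j) = Y $$ (i, j)" .
  qed (use YC in auto)
  have diff: "entanglement_fidelity d \<rho> (\<D> \<circ> \<N> \<circ> \<C>) - entanglement_fidelity d \<rho> (\<D> \<circ> \<N>' \<circ> \<C>)
      = Re (quad_sum (d * c) es Y)"
    unfolding Y_def quad_sum_minus[OF GC GC] fid[OF kN, symmetric] fid[OF kN', symmetric] by simp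
  have GT: "G Ns = id_tensor d c c \<N> \<omega>" "G Ns' = id_tensor d c c \<N>' \<omega>"
    unfolding G_def \<omega>_def id_tensor_gram[OF kN BC] id_tensor_gram[OF kN' BC] by auto
  have Yid: "Y = id_tensor d c c (\<lambda>X. \<N> X - \<N>' X) \<omega>"
    unfolding Y_def GT
    by (rule id_tensor_minus[symmetric]) (erule cptni_carrier[OF N] cptni_carrier[OF N'])+
  have "trace_norm \<omega> = (\<Sum>B\<leftarrow>Bs. frob_sq B)"
    unfolding \<omega>_def trace_norm_gram map_map o_def
    using BC by (intro arg_cong[where f = sum_list] map_cong refl sum_vec_of) blast
  then have \<omega>1: "trace_norm \<omega> \<le> 1" using B1 by simp
  have \<omega>C: "\<omega> \<in> carrier_mat (d * c) (d * c)" by (simp add: \<omega>_def)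
  \<comment> \<open>The supremum is bounded below by its value at ancilla dimension \<open>d\<close>
    and input \<open>\<omega>\<close>, which is admissible since its trace norm is at most
    1.\<close>
  have dia: "ereal (trace_norm Y) \<le> diamond_norm c c (\<lambda>X. \<N> X - \<N>' X)"
    unfolding diamond_norm_def Yid
    using d \<omega>1 \<omega>C by (intro SUP_upper2[of d] SUP_upper2[of \<omega>] order_refl) auto
  have "\<bar>Re (quad_sum (d * c) es Y)\<bar> \<le> trace_norm Y"
    by (rule quad_sum_trace_norm(1)[OF YC Yh contr])
  then show "ereal \<bar>entanglement_fidelity d \<rho> (\<D> \<circ> \<N> \<circ> \<C>) - entanglement_fidelity d \<rho> (\<D> \<circ> \<N>' \<circ> \<C>)\<bar>
      \<le> diamond_norm c c (\<lambda>X. \<N> X - \<N>' X)"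
    unfolding diff using dia order_trans ereal_less_eq(3) by blast
  assume tp: "cptp c c \<N>" "cptp c c \<N>'"
  have "mat_trace Y = mat_trace (G Ns) - mat_trace (G Ns')"
    using GC[of Ns] GC[of Ns'] by (simp add: mat_trace_def Y_def sum_subtractf)
  also have "\<dots> = 0" unfolding GT cptp_trace_id_tensor[OF tp(1)] cptp_trace_id_tensor[OF tp(2)] by simp
  finally have "2 * \<bar>Re (quad_sum (d * c) es Y)\<bar> \<le> trace_norm Y"
    using quad_sum_trace_norm(2)[OF YC Yh contr] by simp
  then show "ereal (2 * \<bar>entanglement_fidelity d \<rho> (\<D> \<circ> \<N> \<circ> \<C>) - entanglement_fidelity d \<rho> (\<D> \<circ> \<N>' \<circ> \<C>)\<bar>)
      \<le> diamond_norm c c (\<lambda>X. \<N> X - \<N>' X)"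
    unfolding diff using dia order_trans ereal_less_eq(3) by blast
qed

lemma abs_cSUP_diff_le:
  fixes f g :: "'a \<Rightarrow> real"
  assumes "S \<noteq> {}" "bdd_above (f ` S)" "bdd_above (g ` S)" "\<And>x. x \<in> S \<Longrightarrow> \<bar>f x - g x\<bar> \<le> \<epsilon>"
  shows "\<bar>Sup (f ` S) - Sup (g ` S)\<bar> \<le> \<epsilon>"
proof -
  have "f x \<le> Sup (g ` S) + \<epsilon>" "g x \<le> Sup (f ` S) + \<epsilon>" if "x \<in> S" for x
    using cSUP_upper[OF that assms(2)] cSUP_upper[OF that assms(3)] assms(4)[OF that] by auto
  then have "Sup (f ` S) \<le> Sup (g ` S) + \<epsilon>" "Sup (g ` S) \<le> Sup (f ` S) + \<epsilon>"
    using assms(1) by (auto intro!: cSUP_least)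
  then show ?thesis by auto
qed

lemma Delta_opt_diff:
  assumes \<rho>: "density_operator dL \<rho>" and d: "1 \<le> dL" and N: "cptni dC dC N" and N': "cptni dC dC N'"
    and le: "\<And>C D. cptni dL dC C \<Longrightarrow> cptni dC dL D \<Longrightarrow>
      \<bar>entanglement_fidelity dL \<rho> (D \<circ> N \<circ> C) - entanglement_fidelity dL \<rho> (D \<circ> N' \<circ> C)\<bar> \<le> \<epsilon>"
  shows "\<bar>Delta_opt dL dC \<rho> N - Delta_opt dL dC \<rho> N'\<bar> \<le> 2 * \<epsilon>"
proof -
  let ?f = "\<lambda>M (C, D). entanglement_fidelity dL \<rho> (D \<circ> M \<circ> C)"
  define S where "S = {(C, D). cptni dL dC C \<and> cptni dC dL D}"
  define S1 where "S1 = {(C, D). cptni dL dC C \<and> cptni dC dL D \<and> choi_rank dL dC C \<le> 1}"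
  have F: "F_opt dL dC \<rho> M = Sup (?f M ` S)" "F_opt1 dL dC \<rho> M = Sup (?f M ` S1)" for M
    unfolding F_opt_def F_opt1_def S_def S1_def by (auto intro!: arg_cong[where f = Sup])
  have ne: "S1 \<noteq> {}" unfolding S1_def
    using cptni_zero[of dL dC] cptni_zero[of dC dL] choi_rank_zero[of dL dC] by fastforce
  have sub: "S1 \<subseteq> S" by (auto simp: S_def S1_def)
  have bdd: "bdd_above (?f M ` S)" if "cptni dC dC M" for M
    \<comment> \<open>The bound by 1 concerns a single channel, so \<open>M\<close> is supplied for
      both.\<close>
    using fidelity_difference(1)[OF \<rho> d _ _ that that] by (auto simp: S_def intro!: bdd_aboveI[of _ 1])
  have \<epsilon>: "\<bar>?f N x - ?f N' x\<bar> \<le> \<epsilon>" if "x \<in> S" for x using that le by (auto simp: S_def)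
  have "\<bar>Sup (?f N ` T) - Sup (?f N' ` T)\<bar> \<le> \<epsilon>" if "T \<noteq> {}" "T \<subseteq> S" for T
  proof (rule abs_cSUP_diff_le)
    show "bdd_above (?f N ` T)" "bdd_above (?f N' ` T)"
      using bdd_above_mono[OF bdd[OF N] image_mono] bdd_above_mono[OF bdd[OF N'] image_mono] that(2) by auto
    show "\<bar>?f N x - ?f N' x\<bar> \<le> \<epsilon>" if "x \<in> T" for x using \<epsilon> that \<open>T \<subseteq> S\<close> by blast
  qed (rule that(1))
  from this[OF ne sub] this[of S] ne sub
  have "\<bar>Sup (?f N ` S) - Sup (?f N' ` S)\<bar> \<le> \<epsilon>" "\<bar>Sup (?f N ` S1) - Sup (?f N' ` S1)\<bar> \<le> \<epsilon>"
    by auto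
  then show ?thesis unfolding Delta_opt_def F by auto
qed

theorem theorem2:
  fixes dL dC :: nat
    and \<rho> :: "complex mat"
    and N N' :: "complex mat \<Rightarrow> complex mat"
  assumes "1 < dL" and "dL \<le> dC"
    and "density_operator dL \<rho>"
    and "cptni dC dC N" and "cptni dC dC N'"
  shows "ereal \<bar>Delta_opt dL dC \<rho> N - Delta_opt dL dC \<rho> N'\<bar>
           \<le> 2 * diamond_norm dC dC (\<lambda>X. N X - N' X) \<and>
         (cptp dC dC N \<and> cptp dC dC N' \<longrightarrow>
           ereal \<bar>Delta_opt dL dC \<rho> N - Delta_opt dL dC \<rho> N'\<bar>
             \<le> diamond_norm dC dC (\<lambda>X. N X - N' X))"
proof -
  have d: "1 \<le> dL" using assms(1) by simp
  note fd = fidelity_difference[OF assms(3) d _ _ assms(4,5)]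
  note Dd = Delta_opt_diff[OF assms(3) d assms(4,5)]
  let ?\<delta> = "diamond_norm dC dC (\<lambda>X. N X - N' X)"
  \<comment> \<open>Any sample encoder and decoder bound the norm below by an absolute value. This
    excludes minus infinity and leaves an infinite norm, where both claims are trivial, or a real
    one.\<close>
  have "ereal 0 \<le> ?\<delta>"
    by (rule order_trans[OF _ fd(2)[OF cptni_zero cptni_zero]]) simp
  then consider "?\<delta> = \<infinity>" | r where "?\<delta> = ereal r" by (cases ?\<delta>) auto
  then show ?thesis
  proof cases
    case 1
    then show ?thesis by simp
  next
    case (2 r)
    have "\<bar>Delta_opt dL dC \<rho> N - Delta_opt dL dC \<rho> N'\<bar> \<le> 2 * r"
      using fd(2)[unfolded 2 ereal_less_eq(3)] by (intro Dd)
    \<comment> \<open>Here each fidelity moves by at most r / 2, so the two suprema together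
      contribute r.\<close>
    moreover have "\<bar>Delta_opt dL dC \<rho> N - Delta_opt dL dC \<rho> N'\<bar> \<le> 2 * (r / 2)"
      if "cptp dC dC N" "cptp dC dC N'"
    proof (intro Dd)
      fix C D assume "cptni dL dC C" "cptni dC dL D"
      from fd(3)[OF this that, unfolded 2 ereal_less_eq(3)]
      show "\<bar>entanglement_fidelity dL \<rho> (D \<circ> N \<circ> C) - entanglement_fidelity dL \<rho> (D \<circ> N' \<circ> C)\<bar> \<le> r / 2"
        by simp
    qed
    ultimately show ?thesis using 2 by simp
  qed
qed

end
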